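(* Let $d\ge1$ be an integer, let $a>1$, and let $\nu$ be a probability measure on $(0,+\infty)$ such that $\int_{(0,+\infty)}r^d\,\nu(dr)<\infty$. There exists $\lambda_0>0$ such that $P^a_{\lambda,\nu}(S\text{ is bounded})=1$ for all $\lambda\in(0,\lambda_0)$ if and only if the integral $$\int_{[1,+\infty)}\beta^d\ln(\beta)\,\nu(d\beta)$$ is finite.
   Context: For $\lambda>0$, let $(\xi_n)_{n\ge0}$ be a sequence of independent Poisson point processes on $\mathbb{R}^d\times(0,+\infty)$, each with intensity measure the product of $\lambda|\cdot|$ ($|\cdot|$ being Lebesgue measure on $\mathbb{R}^d$) and $\nu$. Define $\xi=\bigcup_{n\ge0}a^{-n}\xi_n$, where $a^{-n}\xi_n=\{(a^{-n}c,a^{-n}r):(c,r)\in\xi_n\}$. Set $\Sigma=\bigcup_{(c,r)\in\xi}B(c,r)$, where $B(c,r)$ is the open Euclidean ball with center $c$ and radius $r$, and let $S$ be the connected component of $\Sigma$ containing $0$ ($S=\varnothing$ if $0\notin\Sigma$). $P^a_{\lambda,\nu}$ is the associated probability measure. *)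

theory Defs
  imports "HOL-Probability.Probability"
begin

text \<open>The number of points of \<open>X\<close> lying in \<open>A\<close>, with value \<open>\<infinity>\<close> if there are infinitely many.\<close>

definition num_points :: "'p set \<Rightarrow> 'p set \<Rightarrow> ennreal" where
  "num_points A X = emeasure (count_space UNIV) (X \<inter> A)"

text \<open>
  Point configurations are countable subsets of \<open>space m\<close>; multiplicities are not recorded, which
  loses nothing for the diffuse intensity measures used below. Only the space and the measurable
  sets of \<open>m\<close> matter here.
\<close>

definition configurations :: "'p measure \<Rightarrow> 'p set measure" where
  "configurations m =
     (let \<Omega> = {X. X \<subseteq> space m \<and> countable X}
      in sigma \<Omega> {{X \<in> \<Omega>. num_points A X \<in> B} | A B. A \<in> sets m \<and> B \<in> sets borel})"

text \<open>
  For \<open>m(A) = 0\<close> the Poisson formula gives \<open>num_points A X = 0\<close> almost surely, as \<open>0 ^ 0 = 1\<close>.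
  Independence over a finite family of disjoint sets is the case of a sequence that is
  eventually empty.
\<close>

definition poisson_point_process ::
  "'w measure \<Rightarrow> 'p measure \<Rightarrow> ('w \<Rightarrow> 'p set) \<Rightarrow> bool" where
  "poisson_point_process M m X \<longleftrightarrow>
     prob_space M \<and>
     X \<in> measurable M (configurations m) \<and>
     (\<forall>A\<in>sets m. emeasure m A < \<infinity> \<longrightarrow>
        (\<forall>k::nat. measure M {\<omega> \<in> space M. num_points A (X \<omega>) = of_nat k}
                   = exp (- measure m A) * measure m A ^ k / fact k)) \<and>
     (\<forall>A\<in>sets m. emeasure m A = \<infinity> \<longrightarrow> (AE \<omega> in M. num_points A (X \<omega>) = \<infinity>)) \<and>
     (\<forall>A::nat \<Rightarrow> 'p set. range A \<subseteq> sets m \<and> disjoint_family A \<longrightarrow>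
        prob_space.indep_vars M (\<lambda>_. borel) (\<lambda>i \<omega>. num_points (A i) (X \<omega>)) UNIV)"

definition boolean_intensity ::
  "real \<Rightarrow> real measure \<Rightarrow> ('a::euclidean_space \<times> real) measure" where
  "boolean_intensity lam \<nu> = scale_measure (ennreal lam) lborel \<Otimes>\<^sub>M \<nu>"

definition independent_poisson_sequence ::
  "'w measure \<Rightarrow> 'p measure \<Rightarrow> (nat \<Rightarrow> 'w \<Rightarrow> 'p set) \<Rightarrow> bool" where
  "independent_poisson_sequence M m \<xi> \<longleftrightarrow>
     (\<forall>n. poisson_point_process M m (\<xi> n)) \<and>
     prob_space.indep_vars M (\<lambda>_. configurations m) \<xi> UNIV"

definition multiscale ::
  "real \<Rightarrow> (nat \<Rightarrow> ('a::euclidean_space \<times> real) set) \<Rightarrow> ('a \<times> real) set" where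
  "multiscale a \<xi> = (\<Union>n. (\<lambda>(c, r). ((1 / a ^ n) *\<^sub>R c, r / a ^ n)) ` \<xi> n)"

definition covered :: "('a::euclidean_space \<times> real) set \<Rightarrow> 'a set" where
  "covered X = (\<Union>(c, r)\<in>X. ball c r)"

text \<open>Empty when the origin is not covered, see \<open>connected_component_eq_empty\<close>.\<close>

definition origin_component :: "('a::euclidean_space \<times> real) set \<Rightarrow> 'a set" where
  "origin_component X = connected_component_set (covered X) 0"

end

(*
  Rescaled by a^(-n), the n-th process has points (c, r) with |c| < alpha r and r > a^i of total
  mass proportional to lambda t(i+n), where t(j) is the integral of r^d over r > a^j.  The sum of
  the t(j) is the integral of r^d ceil(log_a r), hence finite iff the logarithmic moment is.

  If the sum diverges, the product over the scales of the probabilities that no ball contains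
  B(0, R) vanishes, so almost surely every B(0, R) lies in a single ball and S is everything.

  If it converges, let p(rho) be the supremum over x of the probability that balls of radius at
  most rho, taken from the scales n < N with a^(-n) <= rho, connect B(x, rho) to the complement of
  B(x, 2 rho).  With L = a^k >= 6, a crossing at radius L rho either uses a ball of radius larger
  than rho or of a newly admitted scale, or forces two crossings at radius rho in disjoint regions,
  so p(L rho) <= K p(rho)^2 + C lambda (sum of the t(j) over j >= log_a rho, plus k while
  rho < 1).  For small lambda the recursion started at p = 0 (no scale admitted) stays below a
  fixed point of order lambda, uniformly in N; beyond rho = 1 there are no new scales and p tends
  to 0.  An unbounded S needs such a crossing for every rho, or a ball of radius larger than rho
  touching B(0, 2 rho), and the probability of the latter also tends to 0.

  Only suprema over x enter, so neither translation nor scale invariance of the law is needed.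
*)
theory Submission
  imports Defs
begin

section \<open>Elementary facts on sequences and powers\<close>

text \<open>Once the errors stay below \<open>r / 4\<close>, halving shrinks the current value
  geometrically while the errors add up to at most \<open>r / 2\<close>. This sends the crossing
  bounds to 0 in the summable case.\<close>

lemma half_recursion_tendsto_0:
  fixes x e :: "nat \<Rightarrow> real"
  assumes "\<And>i. x (Suc i) = x i / 2 + e i" "e \<longlonglongrightarrow> 0"
  shows "x \<longlonglongrightarrow> 0"
proof (rule LIMSEQ_I)
  fix r :: real assume r: "r > 0"
  obtain n where n: "\<And>i. i \<ge> n \<Longrightarrow> \<bar>e i\<bar> < r / 4"
    using LIMSEQ_D[OF assms(2), of "r / 4"] r by auto
  have b: "\<bar>x (n + j)\<bar> \<le> \<bar>x n\<bar> / 2 ^ j + r / 2" for j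
  proof (induction j)
    case 0
    then show ?case using r by simp
  next
    case (Suc j)
    have "\<bar>x (n + Suc j)\<bar> \<le> \<bar>x (n + j)\<bar> / 2 + \<bar>e (n + j)\<bar>"
      using assms(1)[of "n + j"] by simp
    also have "\<dots> \<le> (\<bar>x n\<bar> / 2 ^ j + r / 2) / 2 + r / 4"
      using Suc n[of "n + j"] by (intro add_mono divide_right_mono) auto
    finally show ?case by (simp add: field_simps)
  qed
  have "(\<lambda>j. \<bar>x n\<bar> / 2 ^ j) \<longlonglongrightarrow> 0"
    using tendsto_mult[OF tendsto_const LIMSEQ_power_zero[of "1/2::real"], of "\<bar>x n\<bar>"]
    by (simp add: power_divide)
  then obtain j0 where j0: "\<And>j. j \<ge> j0 \<Longrightarrow> \<bar>x n\<bar> / 2 ^ j < r / 2"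
    using LIMSEQ_D[of "\<lambda>j. \<bar>x n\<bar> / 2 ^ j" 0 "r / 2"] r by auto
  have "norm (x i - 0) < r" if "n + j0 \<le> i" for i
  proof -
    obtain j where j: "i = n + j" "j0 \<le> j"
      using \<open>n + j0 \<le> i\<close> by (intro that[of "i - n"]) auto
    show ?thesis
      unfolding j(1) real_norm_def diff_0_right using b[of j] j0[OF j(2)] by linarith
  qed
  then show "\<exists>no. \<forall>i\<ge>no. norm (x i - 0) < r" by blast
qed

text \<open>The sum counts the exponents \<open>j < log a r\<close>; \<open>nat\<close> makes the
  count 0 when \<open>r \<le> 1\<close>. This is the source of the logarithm in the moment
  condition.\<close>

lemma suminf_indicator_powers:
  assumes "a > 1" "r > 0"
  shows "(\<Sum>j. indicator {a ^ j<..} r :: ennreal) = of_nat (nat \<lceil>log a r\<rceil>)"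
proof -
  have iff: "a ^ j < r \<longleftrightarrow> j < nat \<lceil>log a r\<rceil>" for j
  proof -
    have "a ^ j < r \<longleftrightarrow> real j < log a r"
      using assms by (simp add: less_log_iff powr_realpow)
    then show ?thesis by linarith
  qed
  have "(\<Sum>j. indicator {a ^ j<..} r :: ennreal) = (\<Sum>j<nat \<lceil>log a r\<rceil>. indicator {a ^ j<..} r)"
    using iff by (intro suminf_finite) (auto simp: indicator_def)
  also have "\<dots> = (\<Sum>j<nat \<lceil>log a r\<rceil>. 1)"
    using iff by (intro sum.cong) (auto simp: indicator_def)
  finally show ?thesis by simp
qed

section \<open>Components of unions of balls\<close>

definition linked :: "('a::euclidean_space \<times> real) set \<Rightarrow> (('a \<times> real) \<times> ('a \<times> real)) set" where
  "linked Y = {(u, v). u \<in> Y \<and> v \<in> Y \<and> ball (fst u) (snd u) \<inter> ball (fst v) (snd v) \<noteq> {}}"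

lemma linked_iff:
  "(u, v) \<in> linked Y \<longleftrightarrow> u \<in> Y \<and> v \<in> Y \<and> ball (fst u) (snd u) \<inter> ball (fst v) (snd v) \<noteq> {}"
  by (simp add: linked_def)

lemma mem_covered: "p \<in> covered Z \<longleftrightarrow> (\<exists>u\<in>Z. p \<in> ball (fst u) (snd u))"
  by (auto simp: covered_def split_beta)

lemma covered_mono: "Y \<subseteq> Z \<Longrightarrow> covered Y \<subseteq> covered Z"
  by (auto simp: covered_def)

lemma covered_Un: "covered (Y \<union> Z) = covered Y \<union> covered Z"
  by (auto simp: covered_def)

lemma open_covered: "open (covered Z)"
  unfolding covered_def by auto

lemma linked_mono: "Y \<subseteq> Z \<Longrightarrow> linked Y \<subseteq> linked Z"
  by (auto simp: linked_def)

text \<open>A point common to two consecutive balls joins them; \<open>q\<close> is generalised so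
  that the induction can pass through such a point.\<close>

lemma linked_imp_connected_component:
  assumes "(u, v) \<in> (linked Y)\<^sup>*" "u \<in> Y" "p \<in> ball (fst u) (snd u)" "q \<in> ball (fst v) (snd v)"
  shows "connected_component (covered Y) p q"
  using assms(1,4)
proof (induction arbitrary: q rule: rtrancl_induct)
  case base
  have "ball (fst u) (snd u) \<subseteq> covered Y"
    using assms(2) by (auto simp: mem_covered)
  then show ?case
    using assms(3) base unfolding connected_component_def by (meson connected_ball)
next
  case (step v w)
  then obtain z where z: "z \<in> ball (fst v) (snd v)" "z \<in> ball (fst w) (snd w)"
    and "w \<in> Y" unfolding linked_def by auto
  have "ball (fst w) (snd w) \<subseteq> covered Y"
    using \<open>w \<in> Y\<close> by (auto simp: mem_covered)
  then have "connected_component (covered Y) z q"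
    using z step.prems unfolding connected_component_def by (meson connected_ball)
  with step.IH[OF z(1)] show ?case by (rule connected_component_trans)
qed

text \<open>The balls reachable from \<open>u\<close> and the remaining balls have disjoint open
  unions, so a connected set that starts in the first union stays there.\<close>

lemma connected_component_covered_iff:
  "connected_component (covered Y) p q \<longleftrightarrow>
     (\<exists>u\<in>Y. \<exists>v\<in>Y. p \<in> ball (fst u) (snd u) \<and> q \<in> ball (fst v) (snd v) \<and> (u, v) \<in> (linked Y)\<^sup>*)"
  (is "?L \<longleftrightarrow> ?R")
proof
  assume ?L
  then obtain C where C: "connected C" "C \<subseteq> covered Y" "p \<in> C" "q \<in> C"
    unfolding connected_component_def by auto
  then obtain u where u: "u \<in> Y" "p \<in> ball (fst u) (snd u)"
    using mem_covered by blast
  define T where "T = {v \<in> Y. (u, v) \<in> (linked Y)\<^sup>*}"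
  have disj: "covered T \<inter> covered (Y - T) = {}"
  proof (rule ccontr)
    assume "covered T \<inter> covered (Y - T) \<noteq> {}"
    then obtain z where "z \<in> covered T" "z \<in> covered (Y - T)" by blast
    then obtain v w where "v \<in> T" "w \<in> Y - T" "z \<in> ball (fst v) (snd v)" "z \<in> ball (fst w) (snd w)"
      by (meson mem_covered)
    then have "(v, w) \<in> linked Y" by (auto simp: linked_def T_def)
    then show False
      using \<open>v \<in> T\<close> \<open>w \<in> Y - T\<close> by (auto simp: T_def intro: rtrancl_into_rtrancl)
  qed
  have "T \<union> (Y - T) = Y" by (auto simp: T_def)
  then have "covered Y = covered T \<union> covered (Y - T)"
    using covered_Un[of T "Y - T"] by simp
  then have "C \<subseteq> covered T \<union> covered (Y - T)"
    using C(2) by blast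
  moreover have "u \<in> T" using u by (simp add: T_def)
  then have "p \<in> covered T"
    using u mem_covered by blast
  ultimately have "covered (Y - T) \<inter> C = {}"
    using connectedD[OF C(1) open_covered open_covered, of T "Y - T"] disj C(3) by blast
  then have "q \<in> covered T"
    using \<open>C \<subseteq> covered T \<union> covered (Y - T)\<close> C(4) by blast
  then obtain w where "w \<in> T" "q \<in> ball (fst w) (snd w)"
    using mem_covered by blast
  then show ?R
    using u unfolding T_def by blast
next
  assume ?R then show ?L using linked_imp_connected_component by blast
qed

text \<open>Passing to countably many balls makes connectedness in the covered set a countable
  combination of events of the form ``some point lies in \<open>A\<close>''.\<close>

definition inner_balls :: "'a set \<Rightarrow> ('a::euclidean_space \<times> real) set \<Rightarrow> ('a \<times> real) set" where
  "inner_balls D Z = {u \<in> D \<times> \<rat>. \<exists>w\<in>Z. dist (fst u) (fst w) + snd u \<le> snd w}"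

lemma covered_inner_balls:
  assumes D: "\<And>U. open U \<Longrightarrow> U \<noteq> {} \<Longrightarrow> \<exists>d\<in>D. d \<in> U"
  shows "covered (inner_balls D Z) = covered (Z :: ('a::euclidean_space \<times> real) set)"
proof (intro equalityI subsetI)
  fix p assume "p \<in> covered (inner_balls D Z)"
  then obtain u w where "w \<in> Z" "p \<in> ball (fst u) (snd u)" "dist (fst u) (fst w) + snd u \<le> snd w"
    by (auto simp: mem_covered inner_balls_def)
  moreover have "dist (fst w) p \<le> dist (fst u) (fst w) + dist (fst u) p"
    by (metis dist_commute dist_triangle)
  ultimately have "w \<in> Z" "dist (fst w) p < snd w" by auto
  then show "p \<in> covered Z" by (auto simp: mem_covered)
next
  fix p assume "p \<in> covered Z"
  then obtain w where w: "w \<in> Z" "dist (fst w) p < snd w" by (auto simp: mem_covered)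
  \<comment> \<open>The slack is halved because both the displacement of the centre and the new
    radius are charged against it.\<close>
  obtain s where s: "s \<in> \<rat>" "0 < s" "s < (snd w - dist (fst w) p) / 2"
    using Rats_dense_in_real[of 0 "(snd w - dist (fst w) p) / 2"] w by auto
  obtain d where d: "d \<in> D" "d \<in> ball p s"
    using D[of "ball p s"] s by auto
  have "dist d (fst w) \<le> dist p d + dist (fst w) p"
    by (metis dist_commute dist_triangle)
  then have "dist d (fst w) + s \<le> snd w" using d s by (simp add: field_simps)
  then have "(d, s) \<in> inner_balls D Z" using d s w by (auto simp: inner_balls_def)
  then show "p \<in> covered (inner_balls D Z)"
    using d by (auto simp: mem_covered dist_commute intro!: bexI[of _ "(d, s)"])
qed

text \<open>Induction on the chain length: intermediate balls come from the countable set
  \<open>Q\<close>, so prolonging a chain by one link is a countable union of events.\<close>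

lemma rtrancl_linked_measurable:
  assumes "sigma_algebra \<Omega> F" "countable Q" "\<And>\<omega>. Y \<omega> \<subseteq> Q"
    and mem: "\<And>u. u \<in> Q \<Longrightarrow> {\<omega> \<in> \<Omega>. u \<in> Y \<omega>} \<in> F"
    and "u \<in> Q" "v \<in> Q"
  shows "{\<omega> \<in> \<Omega>. (u, v) \<in> (linked (Y \<omega>))\<^sup>*} \<in> F"
proof -
  interpret sigma_algebra \<Omega> F by fact
  have n: "{\<omega> \<in> \<Omega>. (u, v) \<in> linked (Y \<omega>) ^^ n} \<in> F" if "v \<in> Q" for n v
    using that
  proof (induction n arbitrary: v)
    case 0
    then show ?case by (cases "u = v") auto
  next
    case (Suc n)
    have "{\<omega> \<in> \<Omega>. (u, v) \<in> linked (Y \<omega>) ^^ Suc n} =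
      (\<Union>w\<in>{w\<in>Q. ball (fst w) (snd w) \<inter> ball (fst v) (snd v) \<noteq> {}}.
          {\<omega> \<in> \<Omega>. (u, w) \<in> linked (Y \<omega>) ^^ n} \<inter> ({\<omega> \<in> \<Omega>. w \<in> Y \<omega>} \<inter> {\<omega> \<in> \<Omega>. v \<in> Y \<omega>}))"
      unfolding relpow.simps relcomp_unfold linked_iff using assms(3) by blast
    also have "\<dots> \<in> F"
      using assms(2) Suc.IH mem mem[OF Suc.prems] by (intro countable_UN'' Int) auto
    finally show ?case .
  qed
  have "{\<omega> \<in> \<Omega>. (u, v) \<in> (linked (Y \<omega>))\<^sup>*} = (\<Union>n. {\<omega> \<in> \<Omega>. (u, v) \<in> linked (Y \<omega>) ^^ n})"
    by (auto simp: rtrancl_power)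
  then show ?thesis using n[OF assms(6)] by auto
qed

text \<open>Membership of a fixed ball in \<open>inner_balls\<close> is the event that
  \<open>Z\<close> hits a closed set, and \<open>P\<close> and \<open>P'\<close> only select the
  indices of a countable union. The sigma-algebra is left general so that the lemma can express
  locality as well as measurability.\<close>

lemma connected_component_measurable:
  fixes Z :: "'w \<Rightarrow> ('a::euclidean_space \<times> real) set"
  assumes "sigma_algebra \<Omega> F"
    and hit: "\<And>A. A \<in> sets borel \<Longrightarrow> {\<omega> \<in> \<Omega>. Z \<omega> \<inter> A \<noteq> {}} \<in> F"
  shows "{\<omega> \<in> \<Omega>. \<exists>p\<in>P. \<exists>q\<in>P'. connected_component (covered (Z \<omega>)) p q} \<in> F"
proof -
  interpret sigma_algebra \<Omega> F by fact
  obtain D :: "'a set" where D: "countable D" "\<And>U. open U \<Longrightarrow> U \<noteq> {} \<Longrightarrow> \<exists>d\<in>D. d \<in> U"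
    using countable_dense_setE by blast
  define Y where "Y \<omega> = inner_balls D (Z \<omega>)" for \<omega>
  define Q where "Q = D \<times> (\<rat> :: real set)"
  have Q: "countable Q" unfolding Q_def using D countable_rat by auto
  have YQ: "Y \<omega> \<subseteq> Q" for \<omega> by (auto simp: Y_def Q_def inner_balls_def)
  have mem: "{\<omega> \<in> \<Omega>. u \<in> Y \<omega>} \<in> F" if "u \<in> Q" for u
  proof -
    have "closed {w. dist (fst u) (fst w) + snd u \<le> snd w}"
      by (intro closed_Collect_le continuous_intros)
    then have "{\<omega> \<in> \<Omega>. Z \<omega> \<inter> {w. dist (fst u) (fst w) + snd u \<le> snd w} \<noteq> {}} \<in> F"
      by (intro hit) auto
    also have "{\<omega> \<in> \<Omega>. Z \<omega> \<inter> {w. dist (fst u) (fst w) + snd u \<le> snd w} \<noteq> {}} = {\<omega> \<in> \<Omega>. u \<in> Y \<omega>}"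
      using that by (auto simp: Y_def Q_def inner_balls_def)
    finally show ?thesis .
  qed
  have cov: "covered (Z \<omega>) = covered (Y \<omega>)" for \<omega>
    unfolding Y_def using covered_inner_balls[OF D(2)] by auto
  have "{\<omega> \<in> \<Omega>. \<exists>p\<in>P. \<exists>q\<in>P'. connected_component (covered (Z \<omega>)) p q} =
     (\<Union>u\<in>{u\<in>Q. \<exists>p\<in>P. p \<in> ball (fst u) (snd u)}. \<Union>v\<in>{v\<in>Q. \<exists>q\<in>P'. q \<in> ball (fst v) (snd v)}.
        {\<omega> \<in> \<Omega>. (u, v) \<in> (linked (Y \<omega>))\<^sup>*} \<inter> ({\<omega> \<in> \<Omega>. u \<in> Y \<omega>} \<inter> {\<omega> \<in> \<Omega>. v \<in> Y \<omega>}))"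
    unfolding cov connected_component_covered_iff using YQ by blast
  also have "\<dots> \<in> F"
  proof (intro countable_UN'' Int)
    show "countable {u \<in> Q. \<exists>p\<in>P. p \<in> ball (fst u) (snd u)}"
      "countable {v \<in> Q. \<exists>q\<in>P'. q \<in> ball (fst v) (snd v)}"
      using Q by auto
  qed (use mem rtrancl_linked_measurable[OF assms(1) Q YQ mem] in auto)
  finally show ?thesis .
qed

text \<open>A chain involves finitely many balls, all of which are present at some finite
  stage.\<close>

lemma connected_component_incseq:
  fixes Z :: "nat \<Rightarrow> ('a::euclidean_space \<times> real) set"
  assumes "incseq Z" "connected_component (covered (\<Union>n. Z n)) p q"
  shows "\<exists>n. connected_component (covered (Z n)) p q"
proof -
  let ?Y = "\<Union>n. Z n"
  obtain u v where uv: "u \<in> ?Y" "v \<in> ?Y" "p \<in> ball (fst u) (snd u)" "q \<in> ball (fst v) (snd v)"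
      "(u, v) \<in> (linked ?Y)\<^sup>*"
    using assms(2) unfolding connected_component_covered_iff by blast
  have mono: "Z i \<subseteq> Z j" if "i \<le> j" for i j using assms(1) that by (auto simp: incseq_def)
  have "\<exists>n. u \<in> Z n \<and> (u, v) \<in> (linked (Z n))\<^sup>*"
    using uv(5)
  proof (induction rule: rtrancl_induct)
    case base
    then show ?case using uv by auto
  next
    case (step v w)
    then obtain n i j where n: "u \<in> Z n" "(u, v) \<in> (linked (Z n))\<^sup>*" "v \<in> Z i" "w \<in> Z j"
      by (auto simp: linked_def)
    define k where "k = max n (max i j)"
    have sub: "Z n \<subseteq> Z k" "Z i \<subseteq> Z k" "Z j \<subseteq> Z k" unfolding k_def by (auto intro!: mono)
    have "(v, w) \<in> linked (Z k)" using n sub step.hyps by (auto simp: linked_def)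
    moreover have "(u, v) \<in> (linked (Z k))\<^sup>*"
      using n sub rtrancl_mono[OF linked_mono] by blast
    ultimately show ?case using n sub by (meson rtrancl_into_rtrancl subsetD)
  qed
  then obtain n where "u \<in> Z n" "(u, v) \<in> (linked (Z n))\<^sup>*" by blast
  then show ?thesis using linked_imp_connected_component uv by blast
qed

section \<open>Crossings of annuli\<close>

text \<open>Admitting only balls of radius at most \<rho> centred within \<open>3 * \<rho>\<close>
  makes the event depend on a bounded region, which gives independence for distant centres. Nothing
  is lost when no larger ball touches \<open>ball x (2 * \<rho>)\<close>, by
  \<open>crossingI\<close>.\<close>

definition crossing :: "('a::euclidean_space \<times> real) set \<Rightarrow> 'a \<Rightarrow> real \<Rightarrow> bool" where
  "crossing Z x \<rho> \<longleftrightarrow> (\<exists>p\<in>cball x \<rho>. \<exists>q\<in>- ball x (2 * \<rho>).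
     connected_component (covered (Z \<inter> ball x (3 * \<rho>) \<times> {..\<rho>})) p q)"

lemma crossing_mono: "Y \<subseteq> Z \<Longrightarrow> crossing Y x \<rho> \<Longrightarrow> crossing Z x \<rho>"
  unfolding crossing_def
  by (meson Int_mono connected_component_of_subset covered_mono subset_refl)

text \<open>The localisation step: balls not touching \<open>ball x (2 * \<rho>)\<close> cannot help to leave that ball.\<close>

lemma crossingI:
  assumes C: "connected C" "C \<subseteq> covered Z" "p \<in> C" "q \<in> C" "dist x p \<le> \<rho>" "dist x q \<ge> 2 * \<rho>" "\<rho> > 0"
    and small: "\<And>c r. (c, r) \<in> Z \<Longrightarrow> dist x c < 2 * \<rho> + r \<Longrightarrow> r \<le> \<rho>"
  shows "crossing Z x \<rho>"
proof (rule ccontr)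
  assume nc: "\<not> crossing Z x \<rho>"
  define Y where "Y = Z \<inter> ball x (3 * \<rho>) \<times> {..\<rho>}"
  define K where "K = connected_component_set (covered Y) p"
  have far: "ball (fst u) (snd u) \<inter> ball x (2 * \<rho>) = {}" if "u \<in> Z - Y" for u
  proof (rule ccontr)
    assume "ball (fst u) (snd u) \<inter> ball x (2 * \<rho>) \<noteq> {}"
    then obtain z where "dist (fst u) z < snd u" "dist x z < 2 * \<rho>" by auto
    moreover have "dist x (fst u) \<le> dist x z + dist (fst u) z"
      by (metis dist_commute dist_triangle)
    ultimately have "dist x (fst u) < 2 * \<rho> + snd u" by linarith
    then show False using small[of "fst u" "snd u"] that unfolding Y_def by (cases u) auto
  qed
  have KB: "K \<subseteq> ball x (2 * \<rho>)"
    using nc C(5) unfolding crossing_def K_def Y_def by auto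
  have pY: "p \<in> covered Y"
  proof -
    obtain u where "u \<in> Z" "p \<in> ball (fst u) (snd u)" using C by (meson mem_covered subsetD)
    moreover have "p \<in> ball x (2 * \<rho>)" using C by auto
    ultimately have "u \<in> Y" using far by blast
    then show ?thesis using \<open>p \<in> ball (fst u) (snd u)\<close> mem_covered by blast
  qed
  have oK: "open K" unfolding K_def by (rule open_connected_component[OF open_covered])
  define K' where "K' = \<Union>{connected_component_set (covered Y) y |y. y \<notin> K} \<union> covered (Z - Y)"
  have oK': "open K'" unfolding K'_def
    by (intro open_Un open_covered open_Union) (auto intro: open_connected_component open_covered)
  have "K \<inter> K' = {}"
  proof -
    have "K \<inter> connected_component_set (covered Y) y = {}" if "y \<notin> K" for y
      using that unfolding K_def
      by (metis connected_component_eq_eq connected_component_nonoverlap connected_component_eq_empty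
          connected_component_refl_eq mem_Collect_eq)
    moreover have "K \<inter> covered (Z - Y) = {}"
      using KB far by (fastforce simp: mem_covered)
    ultimately show ?thesis unfolding K'_def by blast
  qed
  moreover have "C \<subseteq> K \<union> K'"
  proof
    fix y assume "y \<in> C"
    then have "y \<in> covered Z" using C(2) by blast
    then have "y \<in> covered Y \<union> covered (Z - Y)" by (auto simp: mem_covered)
    moreover have "y \<in> connected_component_set (covered Y) y" if "y \<in> covered Y"
      using that by simp
    ultimately show "y \<in> K \<union> K'" unfolding K'_def by blast
  qed
  moreover have "p \<in> K \<inter> C" using pY C by (auto simp: K_def)
  ultimately have "K' \<inter> C = {}"
    using connectedD[OF C(1) oK oK'] by blast
  then have "q \<in> ball x (2 * \<rho>)" using \<open>C \<subseteq> K \<union> K'\<close> KB C by blast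
  then show False using C by auto
qed

lemma sphere_finite_cover:
  "\<exists>Y. finite Y \<and> Y \<subseteq> sphere (0::'a::euclidean_space) R \<and> sphere 0 R \<subseteq> (\<Union>y\<in>Y. ball y 1)"
  using seq_compact_imp_totally_bounded[of "sphere (0::'a) R"] compact_sphere[of "0::'a" R]
  by (simp add: compact_eq_seq_compact_metric)

lemma connected_meets_sphere:
  fixes x :: "'a::euclidean_space"
  assumes "connected C" "p \<in> C" "q \<in> C" "dist x p \<le> s" "s \<le> dist x q"
  shows "\<exists>z\<in>C. dist x z = s"
proof -
  have "connected (dist x ` C)"
    by (intro connected_continuous_image continuous_intros assms)
  then have "s \<in> dist x ` C"
    using assms connectedD_interval[of "dist x ` C" "dist x p" "dist x q" s] by auto
  then show ?thesis by auto
qed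

text \<open>Rescaling one unit cover by \<rho> about \<open>x\<close> keeps the number of centres
  independent of the radius, so one constant serves every step.\<close>

lemma sphere_cover_scaled:
  fixes x p :: "'a::euclidean_space"
  assumes "sphere 0 R \<subseteq> (\<Union>y\<in>Y. ball y 1)" "\<rho> > 0" "dist x p = \<rho> * R"
  shows "\<exists>y\<in>Y. dist (x + \<rho> *\<^sub>R y) p < (\<rho>::real)"
proof -
  have "norm ((1/\<rho>) *\<^sub>R (p - x)) = R"
    using assms by (simp add: dist_norm norm_minus_commute)
  then obtain y where y: "y \<in> Y" "dist y ((1/\<rho>) *\<^sub>R (p - x)) < 1"
    using subsetD[OF assms(1), of "(1/\<rho>) *\<^sub>R (p - x)"] by auto
  have "(x + \<rho> *\<^sub>R y) - p = \<rho> *\<^sub>R (y - (1/\<rho>) *\<^sub>R (p - x))"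
    using assms(2) by (simp add: algebra_simps)
  then have "dist (x + \<rho> *\<^sub>R y) p = \<rho> * dist y ((1/\<rho>) *\<^sub>R (p - x))"
    using assms(2) by (simp add: dist_norm)
  also have "\<dots> < \<rho> * 1" using y assms(2) by (intro mult_strict_left_mono) auto
  finally show ?thesis using y by auto
qed

text \<open>The connected set of the large crossing meets the spheres of radii
  \<open>L * \<rho>\<close> and \<open>2 * L * \<rho>\<close> about \<open>x\<close>. A cover centre
  lies within \<rho> of each meeting point, while the other meeting point is at distance at least
  \<open>L * \<rho>\<close> from it, so the set crosses a small annulus around both centres.\<close>

lemma crossing_step:
  fixes x :: "'a::euclidean_space"
  assumes "crossing Z x (L * \<rho>)" and L: "L \<ge> 6" and \<rho>: "\<rho> > 0"
    and Y: "sphere 0 L \<subseteq> (\<Union>y\<in>Y. ball y 1)" "Y \<subseteq> sphere 0 L"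
    and Y': "sphere 0 (2 * L) \<subseteq> (\<Union>y\<in>Y'. ball y 1)" "Y' \<subseteq> sphere 0 (2 * L)"
    and good: "\<And>c r. (c, r) \<in> Z \<Longrightarrow> dist x c < 3 * L * \<rho> \<Longrightarrow> r \<le> L * \<rho> \<Longrightarrow> (c, r) \<in> Z' \<and> r \<le> \<rho>"
  shows "\<exists>y\<in>Y. \<exists>y'\<in>Y'. crossing Z' (x + \<rho> *\<^sub>R y) \<rho> \<and> crossing Z' (x + \<rho> *\<^sub>R y') \<rho>"
proof -
  let ?Z = "Z \<inter> ball x (3 * (L * \<rho>)) \<times> {..L * \<rho>}"
  let ?Z' = "Z' \<inter> UNIV \<times> {..\<rho>}"
  obtain p q where pq: "dist x p \<le> L * \<rho>" "2 * (L * \<rho>) \<le> dist x q" "connected_component (covered ?Z) p q"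
    using assms(1) unfolding crossing_def by (auto simp: not_less)
  have "?Z \<subseteq> ?Z'" using good by auto
  then have "covered ?Z \<subseteq> covered ?Z'" by (rule covered_mono)
  then obtain C where C: "connected C" "C \<subseteq> covered ?Z'" "p \<in> C" "q \<in> C"
    using pq(3) unfolding connected_component_def by blast
  have L\<rho>: "6 * \<rho> \<le> \<rho> * L" using L \<rho> by simp
  have b: "dist x p \<le> \<rho> * L" "\<rho> * L \<le> dist x q" "dist x p \<le> \<rho> * (2 * L)" "\<rho> * (2 * L) \<le> dist x q"
    using pq(1,2) L\<rho> \<rho> by (simp_all only: mult.commute[of L \<rho>] mult.left_commute[of \<rho> 2 L])
  obtain p' where p': "p' \<in> C" "dist x p' = \<rho> * L"
    using connected_meets_sphere[OF C(1,3,4) b(1,2)] by blast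
  obtain q' where q': "q' \<in> C" "dist x q' = \<rho> * (2 * L)"
    using connected_meets_sphere[OF C(1,3,4) b(3,4)] by blast
  obtain y where y: "y \<in> Y" "dist (x + \<rho> *\<^sub>R y) p' < \<rho>"
    using sphere_cover_scaled[OF Y(1) \<rho> p'(2)] by blast
  obtain y' where y': "y' \<in> Y'" "dist (x + \<rho> *\<^sub>R y') q' < \<rho>"
    using sphere_cover_scaled[OF Y'(1) \<rho> q'(2)] by blast
  have cr: "crossing Z' w \<rho>" if "dist w u < \<rho>" "dist w v \<ge> 2 * \<rho>" "u \<in> C" "v \<in> C" for u v w
  proof -
    \<comment> \<open>No radius in \<open>?Z'\<close> exceeds \<rho>, so the smallness hypothesis of
      \<open>crossingI\<close> is immediate.\<close>
    have "crossing ?Z' w \<rho>"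
      using that \<rho> by (intro crossingI[OF C(1,2) that(3,4)]) auto
    then show ?thesis by (rule crossing_mono[rotated]) auto
  qed
  have "dist x (x + \<rho> *\<^sub>R y) = \<rho> * L"
    using subsetD[OF Y(2) y(1)] \<rho> by (simp add: dist_norm)
  moreover have "dist x q' = 2 * (\<rho> * L)" using q'(2) by (simp only: mult.left_commute)
  ultimately have 1: "dist (x + \<rho> *\<^sub>R y) q' \<ge> 2 * \<rho>"
    using dist_triangle[of x q' "x + \<rho> *\<^sub>R y"] L\<rho> \<rho> by linarith
  have "dist x (x + \<rho> *\<^sub>R y') = \<rho> * (2 * L)"
    using subsetD[OF Y'(2) y'(1)] \<rho> by (simp add: dist_norm)
  then have "dist x (x + \<rho> *\<^sub>R y') = 2 * (\<rho> * L)" by (simp only: mult.left_commute)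
  then have 2: "dist (x + \<rho> *\<^sub>R y') p' \<ge> 2 * \<rho>"
    using dist_triangle[of x "x + \<rho> *\<^sub>R y'" p'] dist_commute[of p' "x + \<rho> *\<^sub>R y'"] p'(2) L\<rho> \<rho>
    by linarith
  show ?thesis
    using cr[OF y(2) 1 p'(1) q'(1)] cr[OF y'(2) 2 q'(1) p'(1)] y(1) y'(1) by blast
qed

section \<open>Void probabilities and independence\<close>

text \<open>A set \<open>J\<close> of scales permits work with finitely many processes and the
  gradual admission of coarser scales, that is, smaller \<open>n\<close>.\<close>

definition scales :: "real \<Rightarrow> nat set \<Rightarrow> (nat \<Rightarrow> ('a::euclidean_space \<times> real) set) \<Rightarrow> ('a \<times> real) set" where
  "scales a J \<xi> = (\<Union>n\<in>J. (\<lambda>(c, r). ((1 / a ^ n) *\<^sub>R c, r / a ^ n)) ` \<xi> n)"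

lemma multiscale_eq_scales: "multiscale a \<xi> = scales a UNIV \<xi>"
  by (simp add: multiscale_def scales_def)

lemma scales_mono: "J \<subseteq> K \<Longrightarrow> scales a J \<xi> \<subseteq> scales a K \<xi>"
  by (auto simp: scales_def)

lemma scales_Un: "scales a (J \<union> K) \<xi> = scales a J \<xi> \<union> scales a K \<xi>"
  by (auto simp: scales_def)

lemma scales_UNIV: "scales a UNIV \<xi> = (\<Union>N. scales a {..<N} \<xi>)"
  unfolding scales_def UN_UN_flatten[symmetric] by (simp add: UN_lessThan_UNIV)

lemma num_points_eq_0_iff: "num_points A X = 0 \<longleftrightarrow> X \<inter> A = {}"
  unfolding num_points_def by (subst emeasure_count_space_eq_0) auto

lemma void_in_configurations:
  assumes "A \<in> sets m"
  shows "{X. X \<subseteq> space m \<and> countable X \<and> X \<inter> A = {}} \<in> sets (configurations m)"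
proof -
  let ?\<Omega> = "{X. X \<subseteq> space m \<and> countable X}"
  let ?G = "{{X \<in> ?\<Omega>. num_points A X \<in> B} | A B. A \<in> sets m \<and> B \<in> sets borel}"
  have "sets (configurations m) = sigma_sets ?\<Omega> ?G"
    unfolding configurations_def Let_def by (rule sets_measure_of) auto
  moreover have "{X \<in> ?\<Omega>. num_points A X \<in> {0}} \<in> ?G"
    by (rule CollectI, rule exI[of _ A], rule exI[of _ "{0}"]) (simp add: assms)
  moreover have "{X. X \<subseteq> space m \<and> countable X \<and> X \<inter> A = {}} = {X \<in> ?\<Omega>. num_points A X \<in> {0}}"
    by (auto simp: num_points_eq_0_iff)
  ultimately show ?thesis by (simp only: sigma_sets.Basic)
qed

lemma space_configurations: "space (configurations m) = {X. X \<subseteq> space m \<and> countable X}"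
  unfolding configurations_def Let_def by (rule space_measure_of) auto

text \<open>One fixed intensity; the final theorem interprets the locale separately at each
  intensity it uses.\<close>

locale multiscale_boolean = prob_space M
  for M :: "'w measure" +
  fixes a lam :: real and \<nu> :: "real measure"
    and \<xi> :: "nat \<Rightarrow> 'w \<Rightarrow> ('a::euclidean_space \<times> real) set"
  assumes a_gt_1: "a > 1"
    and lam_pos: "lam > 0"
    and prob_\<nu>: "prob_space \<nu>"
    and sets_\<nu>: "sets \<nu> = sets (restrict_space borel {0<..})"
    and poisson: "independent_poisson_sequence M (boolean_intensity lam \<nu>) \<xi>"
    and moment: "(\<integral>\<^sup>+ r. ennreal (r ^ DIM('a)) \<partial>\<nu>) < \<infinity>"
begin

abbreviation m :: "('a \<times> real) measure" where "m \<equiv> boolean_intensity lam \<nu>"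

abbreviation Z :: "nat set \<Rightarrow> 'w \<Rightarrow> ('a \<times> real) set" where
  "Z J \<omega> \<equiv> scales a J (\<lambda>n. \<xi> n \<omega>)"

text \<open>\<open>\<xi> n\<close> meets \<open>pre n A\<close> exactly when the rescaled \<open>n\<close>-th process meets \<open>A\<close>.\<close>

definition pre :: "nat \<Rightarrow> ('a \<times> real) set \<Rightarrow> ('a \<times> real) set" where
  "pre n A = (\<lambda>(c, r). ((1 / a ^ n) *\<^sub>R c, r / a ^ n)) -` A \<inter> space m"

lemma a_pow_pos: "a ^ n > 0"
  using a_gt_1 by simp

lemma space_\<nu>: "space \<nu> = {0<..}"
  using sets_eq_imp_space_eq[OF sets_\<nu>] by (simp add: space_restrict_space)

lemma space_m: "space m = UNIV \<times> {0<..}"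
  by (simp add: boolean_intensity_def space_pair_measure space_scale_measure space_\<nu>)

lemma measurable_id_\<nu>: "(\<lambda>r. r) \<in> borel_measurable \<nu>"
  unfolding measurable_cong_sets[OF sets_\<nu> refl] by (rule measurable_restrict_space1) simp

lemma sets_pre: "A \<in> sets borel \<Longrightarrow> pre n A \<in> sets m"
proof -
  assume A: "A \<in> sets borel"
  have 1: "fst \<in> borel_measurable m"
    using measurable_fst[of "scale_measure (ennreal lam) lborel" \<nu>]
      measurable_cong_sets[of m m "scale_measure (ennreal lam) lborel" borel]
    unfolding boolean_intensity_def by simp
  have 2: "snd \<in> borel_measurable m"
    unfolding boolean_intensity_def by (rule measurable_compose[OF measurable_snd measurable_id_\<nu>])
  have "(\<lambda>x. ((1 / a ^ n) *\<^sub>R fst x, snd x / a ^ n)) \<in> borel_measurable m"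
    by (intro borel_measurable_Pair borel_measurable_scaleR borel_measurable_divide borel_measurable_const 1 2)
  from measurable_sets[OF this A] show ?thesis
    by (simp add: pre_def case_prod_beta')
qed

lemma pre_Un: "pre n (A \<union> B) = pre n A \<union> pre n B"
  by (auto simp: pre_def)

lemma pre_disjoint: "A \<inter> B = {} \<Longrightarrow> pre n A \<inter> pre n B = {}"
  by (auto simp: pre_def)

lemma \<xi>_measurable: "\<xi> n \<in> measurable M (configurations m)"
  using poisson by (auto simp: independent_poisson_sequence_def poisson_point_process_def)

lemma \<xi>_space: "\<omega> \<in> space M \<Longrightarrow> \<xi> n \<omega> \<subseteq> space m \<and> countable (\<xi> n \<omega>)"
  using measurable_space[OF \<xi>_measurable] by (auto simp: space_configurations)

lemma void_eq:
  "{\<omega> \<in> space M. \<xi> n \<omega> \<inter> A = {}} =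
     \<xi> n -` {X. X \<subseteq> space m \<and> countable X \<and> X \<inter> A = {}} \<inter> space M"
  using \<xi>_space by auto

lemma void_event: "A \<in> sets m \<Longrightarrow> {\<omega> \<in> space M. \<xi> n \<omega> \<inter> A = {}} \<in> events"
  unfolding void_eq by (intro measurable_sets[OF \<xi>_measurable] void_in_configurations)

lemma prob_void1:
  assumes "A \<in> sets m" "emeasure m A < \<infinity>"
  shows "prob {\<omega> \<in> space M. \<xi> n \<omega> \<inter> A = {}} = exp (- measure m A)"
proof -
  have "prob {\<omega> \<in> space M. num_points A (\<xi> n \<omega>) = of_nat 0} = exp (- measure m A) * measure m A ^ 0 / fact 0"
    using poisson assms unfolding independent_poisson_sequence_def poisson_point_process_def by blast
  then show ?thesis by (simp add: num_points_eq_0_iff)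
qed

lemma prob_void:
  assumes "finite J" "\<And>n. n \<in> J \<Longrightarrow> A n \<in> sets m" "\<And>n. n \<in> J \<Longrightarrow> emeasure m (A n) < \<infinity>"
  shows "prob {\<omega> \<in> space M. \<forall>n\<in>J. \<xi> n \<omega> \<inter> A n = {}} = exp (- (\<Sum>n\<in>J. measure m (A n)))"
\<comment> \<open>The product rule for independent events asks for a nonempty index set, and an
  empty intersection would be \<open>UNIV\<close> instead of the sample space.\<close>
proof (cases "J = {}")
  case True
  then show ?thesis by (simp add: prob_space)
next
  case False
  let ?B = "\<lambda>n. {X. X \<subseteq> space m \<and> countable X \<and> X \<inter> A n = {}}"
  have ind: "indep_vars (\<lambda>_. configurations m) \<xi> UNIV"
    using poisson by (simp add: independent_poisson_sequence_def)
  have ind: "indep_vars (\<lambda>_. configurations m) \<xi> J"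
    by (rule indep_vars_subset[OF ind]) auto
  have "{\<omega> \<in> space M. \<forall>n\<in>J. \<xi> n \<omega> \<inter> A n = {}} = (\<Inter>n\<in>J. \<xi> n -` ?B n \<inter> space M)"
    unfolding void_eq[symmetric] using False by auto
  also have "prob \<dots> = (\<Prod>n\<in>J. prob (\<xi> n -` ?B n \<inter> space M))"
    using assms False by (intro indep_varsD_finite[OF ind]) (auto intro: void_in_configurations)
  also have "\<dots> = (\<Prod>n\<in>J. exp (- measure m (A n)))"
    unfolding void_eq[symmetric] using assms by (intro prod.cong) (auto intro: prob_void1)
  finally show ?thesis using exp_sum[OF assms(1), of "\<lambda>n. - measure m (A n)"] by (simp add: sum_negf)
qed

lemma Z_void_iff:
  "\<omega> \<in> space M \<Longrightarrow> Z J \<omega> \<inter> A = {} \<longleftrightarrow> (\<forall>n\<in>J. \<xi> n \<omega> \<inter> pre n A = {})"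
proof -
  assume \<omega>: "\<omega> \<in> space M"
  have "\<xi> n \<omega> \<inter> pre n A = \<xi> n \<omega> \<inter> (\<lambda>(c, r). ((1 / a ^ n) *\<^sub>R c, r / a ^ n)) -` A" for n
    using \<xi>_space[OF \<omega>, of n] by (auto simp: pre_def)
  moreover have "f ` X \<inter> A = {} \<longleftrightarrow> X \<inter> f -` A = {}" for f :: "'a \<times> real \<Rightarrow> 'a \<times> real" and X
    by blast
  moreover have "(\<Union>n\<in>J. X n) \<inter> A = {} \<longleftrightarrow> (\<forall>n\<in>J. X n \<inter> A = {})" for X :: "nat \<Rightarrow> ('a \<times> real) set"
    by blast
  ultimately show ?thesis by (simp add: scales_def)
qed

lemma Z_void_event:
  assumes "A \<in> sets borel" shows "{\<omega> \<in> space M. Z J \<omega> \<inter> A = {}} \<in> events"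
proof -
  have "{\<omega> \<in> space M. Z J \<omega> \<inter> A = {}} = {\<omega> \<in> space M. \<forall>n\<in>J. \<xi> n \<omega> \<inter> pre n A = {}}"
    by (intro Collect_cong conj_cong refl Z_void_iff)
  also have "\<dots> \<in> events"
    using void_event[OF sets_pre[OF assms]] by (intro sets.sets_Collect_countable_Ball) auto
  finally show ?thesis .
qed

lemma Z_hit_event:
  assumes "A \<in> sets borel" shows "{\<omega> \<in> space M. Z J \<omega> \<inter> A \<noteq> {}} \<in> events"
  using sets.compl_sets[OF Z_void_event[OF assms]]
  by (rule back_subst[where P="\<lambda>x. x \<in> events"]) auto

lemma prob_Z_void:
  assumes "finite J" "A \<in> sets borel" "\<And>n. n \<in> J \<Longrightarrow> emeasure m (pre n A) < \<infinity>"
  shows "prob {\<omega> \<in> space M. Z J \<omega> \<inter> A = {}} = exp (- (\<Sum>n\<in>J. measure m (pre n A)))"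
proof -
  have "{\<omega> \<in> space M. Z J \<omega> \<inter> A = {}} = {\<omega> \<in> space M. \<forall>n\<in>J. \<xi> n \<omega> \<inter> pre n A = {}}"
    by (intro Collect_cong conj_cong refl Z_void_iff)
  then show ?thesis using prob_void[of J "\<lambda>n. pre n A"] assms sets_pre by simp
qed

text \<open>From \<open>1 - exp (- x) \<le> x\<close>.\<close>

lemma prob_Z_hit_le:
  assumes "finite J" "A \<in> sets borel" "\<And>n. n \<in> J \<Longrightarrow> emeasure m (pre n A) < \<infinity>"
  shows "prob {\<omega> \<in> space M. Z J \<omega> \<inter> A \<noteq> {}} \<le> (\<Sum>n\<in>J. measure m (pre n A))"
proof -
  have eq: "{\<omega> \<in> space M. Z J \<omega> \<inter> A \<noteq> {}} = space M - {\<omega> \<in> space M. Z J \<omega> \<inter> A = {}}" by auto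
  have "prob {\<omega> \<in> space M. Z J \<omega> \<inter> A \<noteq> {}} = 1 - exp (- (\<Sum>n\<in>J. measure m (pre n A)))"
    by (simp only: eq prob_compl[OF Z_void_event[OF assms(2)]] prob_Z_void[OF assms])
  then show ?thesis
    using exp_ge_add_one_self[of "- (\<Sum>n\<in>J. measure m (pre n A))"] by linarith
qed

definition void :: "nat set \<Rightarrow> ('a \<times> real) set \<Rightarrow> 'w set" where
  "void J A = {\<omega> \<in> space M. Z J \<omega> \<inter> A = {}}"

lemma void_Int: "void J A \<inter> void J B = void J (A \<union> B)"
  by (auto simp: void_def)

text \<open>A generator of the events that look only at points in \<open>W\<close>; locality of
  crossings is stated through it.\<close>

definition voids :: "nat set \<Rightarrow> ('a \<times> real) set \<Rightarrow> 'w set set" where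
  "voids J W = void J ` {A \<in> sets borel. A \<subseteq> W}"

lemma voids_events: "voids J W \<subseteq> events"
  unfolding voids_def void_def using Z_void_event by blast

lemma Int_stable_voids: "Int_stable (voids J W)"
proof (rule Int_stableI)
  fix E F assume "E \<in> voids J W" "F \<in> voids J W"
  then obtain A B where "A \<in> sets borel" "A \<subseteq> W" "B \<in> sets borel" "B \<subseteq> W" "E = void J A" "F = void J B"
    unfolding voids_def by blast
  then show "E \<inter> F \<in> voids J W"
    unfolding voids_def by (simp add: void_Int)
qed

lemma prob_void_Un:
  assumes "finite J" "A \<inter> B = {}" "A \<in> sets borel" "B \<in> sets borel"
    and fin: "\<And>n. n \<in> J \<Longrightarrow> emeasure m (pre n (A \<union> B)) < \<infinity>"
  shows "prob (void J (A \<union> B)) = prob (void J A) * prob (void J B)"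
proof -
  have A: "emeasure m (pre n A) < \<infinity>" if "n \<in> J" for n
  proof -
    have "emeasure m (pre n A) \<le> emeasure m (pre n (A \<union> B))"
      by (intro emeasure_mono sets_pre sets.Un assms(3,4)) (simp add: pre_Un)
    then show ?thesis using fin[OF that] by (rule order_le_less_trans)
  qed
  have B: "emeasure m (pre n B) < \<infinity>" if "n \<in> J" for n
  proof -
    have "emeasure m (pre n B) \<le> emeasure m (pre n (A \<union> B))"
      by (intro emeasure_mono sets_pre sets.Un assms(3,4)) (simp add: pre_Un)
    then show ?thesis using fin[OF that] by (rule order_le_less_trans)
  qed
  have "measure m (pre n (A \<union> B)) = measure m (pre n A) + measure m (pre n B)" if "n \<in> J" for n
    unfolding pre_Un using A[OF that] B[OF that]
    by (intro measure_Union sets_pre pre_disjoint assms) simp_all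
  then have "(\<Sum>n\<in>J. measure m (pre n (A \<union> B))) = (\<Sum>n\<in>J. measure m (pre n A)) + (\<Sum>n\<in>J. measure m (pre n B))"
    by (simp add: sum.distrib)
  moreover have "A \<union> B \<in> sets borel" using assms by auto
  ultimately show ?thesis
    unfolding void_def using prob_Z_void[OF assms(1) _ fin]
    by (simp add: prob_Z_void[OF assms(1,3) A] prob_Z_void[OF assms(1,4) B] mult_exp_exp)
qed

text \<open>Void events form an intersection-stable generator, so the void probabilities together with
  independence across scales are all that is used of the Poisson processes.\<close>

lemma indep_voids:
  assumes "finite J" "U \<inter> U' = {}"
    and fin: "\<And>n A. n \<in> J \<Longrightarrow> A \<in> sets borel \<Longrightarrow> A \<subseteq> U \<union> U' \<Longrightarrow> emeasure m (pre n A) < \<infinity>"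
  shows "indep_set (sigma_sets (space M) (voids J U)) (sigma_sets (space M) (voids J U'))"
proof (rule indep_set_sigma_sets[OF _ Int_stable_voids Int_stable_voids])
  show "indep_set (voids J U) (voids J U')"
  proof (rule indep_setI[OF voids_events voids_events])
    fix E F assume "E \<in> voids J U" "F \<in> voids J U'"
    then obtain A B where AB: "A \<in> sets borel" "A \<subseteq> U" "B \<in> sets borel" "B \<subseteq> U'"
      and EF: "E = void J A" "F = void J B" unfolding voids_def by blast
    have "prob (void J (A \<union> B)) = prob (void J A) * prob (void J B)"
      using AB assms(2) by (intro prob_void_Un assms(1) fin) auto
    then show "prob (E \<inter> F) = prob E * prob F" by (simp add: EF void_Int)
  qed
qed

section \<open>Intensity estimates\<close>

text \<open>At \<open>s = a ^ j\<close> this is the \<open>t(j)\<close> of the outline.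
  \<open>enn2real\<close> loses nothing, since \<open>moment\<close> keeps the integral
  finite.\<close>

definition tail :: "real \<Rightarrow> real" where
  "tail s = enn2real (\<integral>\<^sup>+ r\<in>{s<..}. ennreal (r ^ DIM('a)) \<partial>\<nu>)"

lemma tail_nonneg: "tail s \<ge> 0"
  by (simp add: tail_def)

lemma ennreal_tail: "ennreal (tail s) = (\<integral>\<^sup>+ r\<in>{s<..}. ennreal (r ^ DIM('a)) \<partial>\<nu>)"
proof -
  have "(\<integral>\<^sup>+ r\<in>{s<..}. ennreal (r ^ DIM('a)) \<partial>\<nu>) \<le> (\<integral>\<^sup>+ r. ennreal (r ^ DIM('a)) \<partial>\<nu>)"
    by (intro nn_integral_mono) (auto simp: indicator_def)
  also have "\<dots> < top" using moment by simp
  finally show ?thesis by (simp add: tail_def)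
qed

lemma sets_\<nu>_borel: "B \<in> sets borel \<Longrightarrow> {r \<in> space \<nu>. r \<in> B} \<in> sets \<nu>"
  using measurable_sets[OF measurable_id_\<nu>, of B] by (simp add: vimage_def Int_def conj_commute)

lemma markov_tail:
  assumes "s > 0"
  shows "ennreal (s ^ DIM('a)) * emeasure \<nu> {r \<in> space \<nu>. s < r} \<le> ennreal (tail s)"
proof -
  have S: "{r \<in> space \<nu>. s < r} \<in> sets \<nu>" using sets_\<nu>_borel[of "{s<..}"] by simp
  have "ennreal (s ^ DIM('a)) * emeasure \<nu> {r \<in> space \<nu>. s < r} =
      (\<integral>\<^sup>+ r. ennreal (s ^ DIM('a)) * indicator {r \<in> space \<nu>. s < r} r \<partial>\<nu>)"
    using S by (simp add: nn_integral_cmult_indicator)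
  also have "\<dots> \<le> (\<integral>\<^sup>+ r\<in>{s<..}. ennreal (r ^ DIM('a)) \<partial>\<nu>)"
    using assms by (intro nn_integral_mono) (auto simp: indicator_def intro!: ennreal_leI power_mono)
  finally show ?thesis by (simp add: ennreal_tail)
qed

lemma emeasure_m_Times:
  assumes "A \<in> sets borel" "B \<in> sets \<nu>"
  shows "emeasure m (A \<times> B) = ennreal lam * emeasure lborel A * emeasure \<nu> B"
proof -
  interpret \<nu>: prob_space \<nu> by (rule prob_\<nu>)
  show ?thesis
    unfolding boolean_intensity_def using assms by (subst \<nu>.emeasure_pair_measure_Times) auto
qed

lemma pre_ball_Times:
  "pre n (ball x R \<times> T) = ball (a ^ n *\<^sub>R x) (R * a ^ n) \<times> {r \<in> space \<nu>. r / a ^ n \<in> T}"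
proof -
  have "dist x ((1 / a ^ n) *\<^sub>R c) < R \<longleftrightarrow> dist (a ^ n *\<^sub>R x) c < R * a ^ n" for c
  proof -
    have "dist (a ^ n *\<^sub>R x) c = norm (a ^ n *\<^sub>R (x - (1 / a ^ n) *\<^sub>R c))"
      using a_pow_pos[of n] a_gt_1 by (simp add: dist_norm algebra_simps)
    also have "\<dots> = a ^ n * dist x ((1 / a ^ n) *\<^sub>R c)"
      using a_gt_1 by (simp add: dist_norm)
    finally show ?thesis using a_gt_1 by (simp add: mult.commute)
  qed
  then show ?thesis by (auto simp: pre_def space_m space_\<nu>)
qed

definition v :: real where "v = unit_ball_vol (DIM('a))"

lemma v_pos: "v > 0" by (simp add: v_def unit_ball_vol_pos)

lemma emeasure_pre_ball_Times:
  assumes "T \<in> sets borel" "R \<ge> 0"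
  shows "emeasure m (pre n (ball x R \<times> T)) =
    ennreal (lam * v * (R * a ^ n) ^ DIM('a)) * emeasure \<nu> {r \<in> space \<nu>. r / a ^ n \<in> T}"
proof -
  have "{r \<in> space \<nu>. r \<in> (\<lambda>r. r / a ^ n) -` T} \<in> sets \<nu>"
  proof (rule sets_\<nu>_borel)
    have "(\<lambda>r::real. r / a ^ n) \<in> borel_measurable borel" by measurable
    from measurable_sets[OF this assms(1)] show "(\<lambda>r. r / a ^ n) -` T \<in> sets borel" by simp
  qed
  then have "{r \<in> space \<nu>. r / a ^ n \<in> T} \<in> sets \<nu>" by simp
  moreover have "R * a ^ n \<ge> 0" using assms(2) a_gt_1 by simp
  ultimately show ?thesis unfolding pre_ball_Times
    using lam_pos v_pos by (simp add: emeasure_m_Times emeasure_ball v_def[symmetric] ennreal_mult' mult_ac)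
qed

lemma pre_mono: "A \<subseteq> B \<Longrightarrow> pre n A \<subseteq> pre n B"
  by (auto simp: pre_def)

lemma emeasure_\<nu>_le_1: "emeasure \<nu> A \<le> 1"
proof -
  interpret \<nu>: prob_space \<nu> by (rule prob_\<nu>)
  show ?thesis by (rule \<nu>.emeasure_le_1)
qed

lemma borel_Times: "A \<in> sets borel \<Longrightarrow> B \<in> sets borel \<Longrightarrow> A \<times> B \<in> sets (borel :: ('a \<times> real) measure)"
  by (simp add: borel_prod[symmetric])

lemma measure_pre_le:
  assumes "emeasure m (pre n A) \<le> ennreal b" "b \<ge> 0"
  shows "emeasure m (pre n A) < \<infinity>" "measure m (pre n A) \<le> b"
proof -
  show "emeasure m (pre n A) < \<infinity>" using assms(1) by (rule order_le_less_trans) simp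
  show "measure m (pre n A) \<le> b"
    unfolding measure_def using enn2real_mono[OF assms(1)] assms(2) by simp
qed

lemma emeasure_pre_ball_UNIV_le:
  assumes "R \<ge> 0"
  shows "emeasure m (pre n (ball x R \<times> UNIV)) \<le> ennreal (lam * v * (R * a ^ n) ^ DIM('a))"
  using mult_left_mono[OF emeasure_\<nu>_le_1[of "space \<nu>"], of "ennreal (lam * v * (R * a ^ n) ^ DIM('a))"]
  by (simp add: emeasure_pre_ball_Times assms)

lemma emeasure_pre_bounded:
  assumes "A \<subseteq> ball x R \<times> UNIV" "R \<ge> 0"
  shows "emeasure m (pre n A) < \<infinity>"
proof -
  have "emeasure m (pre n A) \<le> emeasure m (pre n (ball x R \<times> UNIV))"
    by (intro emeasure_mono pre_mono assms sets_pre borel_Times) auto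
  also have "\<dots> < \<infinity>"
    using emeasure_pre_ball_UNIV_le[OF assms(2)] by (rule order_le_less_trans) simp
  finally show ?thesis .
qed

text \<open>Markov's inequality trades the volume factor for a tail. The prefactor depends on the
  radii only through \<open>R / \<rho>\<close>, hence is the same at every step of the
  recursion.\<close>

lemma emeasure_pre_ball_tail_le:
  assumes "R \<ge> 0" "\<rho> > 0"
  shows "emeasure m (pre n (ball x R \<times> {\<rho><..})) \<le> ennreal (lam * v * (R / \<rho>) ^ DIM('a) * tail (\<rho> * a ^ n))"
proof -
  have eq: "lam * v * (R * a ^ n) ^ DIM('a) = lam * v * (R / \<rho>) ^ DIM('a) * (\<rho> * a ^ n) ^ DIM('a)"
    using assms by (simp add: power_mult_distrib power_divide)
  have split: "ennreal (lam * v * (R * a ^ n) ^ DIM('a)) =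
      ennreal (lam * v * (R / \<rho>) ^ DIM('a)) * ennreal ((\<rho> * a ^ n) ^ DIM('a))"
    unfolding eq using assms a_gt_1 by (intro ennreal_mult'') simp
  have "{r \<in> space \<nu>. r / a ^ n \<in> {\<rho><..}} = {r \<in> space \<nu>. \<rho> * a ^ n < r}"
    using a_pow_pos[of n] by (auto simp: field_simps)
  then have "emeasure m (pre n (ball x R \<times> {\<rho><..})) =
      ennreal (lam * v * (R / \<rho>) ^ DIM('a)) *
        (ennreal ((\<rho> * a ^ n) ^ DIM('a)) * emeasure \<nu> {r \<in> space \<nu>. \<rho> * a ^ n < r})"
    using emeasure_pre_ball_Times[of "{\<rho><..}" R n x] assms(1) split by (simp add: mult.assoc)
  also have "\<dots> \<le> ennreal (lam * v * (R / \<rho>) ^ DIM('a)) * ennreal (tail (\<rho> * a ^ n))"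
    using assms a_gt_1 by (intro mult_left_mono markov_tail) auto
  also have "\<dots> = ennreal (lam * v * (R / \<rho>) ^ DIM('a) * tail (\<rho> * a ^ n))"
    by (rule ennreal_mult''[symmetric, OF tail_nonneg])
  finally show ?thesis .
qed

section \<open>Crossing probabilities\<close>

lemma crossing_local:
  "{\<omega> \<in> space M. crossing (Z J \<omega>) x \<rho>} \<in> sigma_sets (space M) (voids J (ball x (3 * \<rho>) \<times> UNIV))"
  (is "_ \<in> ?F")
  unfolding crossing_def
proof (rule connected_component_measurable)
  show "sigma_algebra (space M) ?F"
    using voids_events sets.space_closed by (intro sigma_algebra_sigma_sets) blast
  fix A :: "('a \<times> real) set" assume "A \<in> sets borel"
  let ?A = "ball x (3 * \<rho>) \<times> {..\<rho>} \<inter> A"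
  have "?A \<in> sets borel" using \<open>A \<in> sets borel\<close> by (intro sets.Int borel_Times) auto
  moreover have "?A \<subseteq> ball x (3 * \<rho>) \<times> UNIV" by auto
  ultimately have "void J ?A \<in> voids J (ball x (3 * \<rho>) \<times> UNIV)"
    unfolding voids_def by (intro imageI) simp
  then have "space M - void J ?A \<in> ?F"
    by (intro sigma_sets.Compl sigma_sets.Basic)
  moreover have "space M - void J ?A = {\<omega> \<in> space M. Z J \<omega> \<inter> ball x (3 * \<rho>) \<times> {..\<rho>} \<inter> A \<noteq> {}}"
    unfolding void_def Int_assoc by blast
  ultimately show "{\<omega> \<in> space M. Z J \<omega> \<inter> ball x (3 * \<rho>) \<times> {..\<rho>} \<inter> A \<noteq> {}} \<in> ?F"
    by (simp only:)
qed

lemma crossing_event: "{\<omega> \<in> space M. crossing (Z J \<omega>) x \<rho>} \<in> events"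
  using crossing_local sets.sigma_sets_subset[OF voids_events] by (rule subsetD[rotated])

lemma prob_crossing_Int:
  assumes "finite J" "ball x (3 * \<rho>) \<inter> ball y (3 * \<rho>) = {}" "\<rho> > 0"
  shows "prob ({\<omega> \<in> space M. crossing (Z J \<omega>) x \<rho>} \<inter> {\<omega> \<in> space M. crossing (Z J \<omega>) y \<rho>}) =
     prob {\<omega> \<in> space M. crossing (Z J \<omega>) x \<rho>} * prob {\<omega> \<in> space M. crossing (Z J \<omega>) y \<rho>}"
proof (rule indep_setD[OF indep_voids crossing_local crossing_local])
  show "ball x (3 * \<rho>) \<times> UNIV \<inter> ball y (3 * \<rho>) \<times> (UNIV :: real set) = {}"
    using assms(2) by auto
  fix n and A :: "('a \<times> real) set"
  assume A: "A \<in> sets borel" "A \<subseteq> ball x (3 * \<rho>) \<times> UNIV \<union> ball y (3 * \<rho>) \<times> UNIV"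
  \<comment> \<open>A single ball containing both regions supplies the finite intensities that
    independence requires.\<close>
  have "ball y (3 * \<rho>) \<subseteq> ball x (dist x y + 3 * \<rho>)"
  proof
    fix z assume "z \<in> ball y (3 * \<rho>)"
    then show "z \<in> ball x (dist x y + 3 * \<rho>)" using dist_triangle[of x z y] by simp
  qed
  moreover have "ball x (3 * \<rho>) \<subseteq> ball x (dist x y + 3 * \<rho>)" by (intro subset_ball) simp
  ultimately have "A \<subseteq> ball x (dist x y + 3 * \<rho>) \<times> UNIV" using A(2) by blast
  then show "emeasure m (pre n A) < \<infinity>"
    by (rule emeasure_pre_bounded) (use assms(3) in simp)
qed fact

lemma prob_crossing_step:
  assumes J: "finite J" "J' \<subseteq> J" and L: "L \<ge> 6" and \<rho>: "\<rho> > 0"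
    and Y: "sphere (0::'a) L \<subseteq> (\<Union>y\<in>Y. ball y 1)" "Y \<subseteq> sphere 0 L" "finite Y"
    and Y': "sphere (0::'a) (2 * L) \<subseteq> (\<Union>y\<in>Y'. ball y 1)" "Y' \<subseteq> sphere 0 (2 * L)" "finite Y'"
    and p: "\<And>x. prob {\<omega> \<in> space M. crossing (Z J' \<omega>) x \<rho>} \<le> p"
    and old: "(\<Sum>n\<in>J'. tail (\<rho> * a ^ n)) \<le> b"
    and new: "\<And>n. n \<in> J - J' \<Longrightarrow> \<rho> * a ^ n \<le> 1" "card (J - J') \<le> k"
  shows "prob {\<omega> \<in> space M. crossing (Z J \<omega>) x (L * \<rho>)} \<le>
     real (card Y * card Y') * p\<^sup>2 + lam * v * (3 * L) ^ DIM('a) * (b + real k)"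
proof -
  let ?c = "lam * v * (3 * L) ^ DIM('a)"
  let ?A1 = "ball x (3 * L * \<rho>) \<times> {\<rho><..}" and ?A2 = "ball x (3 * L * \<rho>) \<times> (UNIV :: real set)"
  let ?E = "\<lambda>y. {\<omega> \<in> space M. crossing (Z J' \<omega>) (x + \<rho> *\<^sub>R y) \<rho>}"
  let ?B1 = "{\<omega> \<in> space M. Z J' \<omega> \<inter> ?A1 \<noteq> {}}"
  let ?B2 = "{\<omega> \<in> space M. Z (J - J') \<omega> \<inter> ?A2 \<noteq> {}}"
  let ?U = "\<Union>z\<in>Y \<times> Y'. ?E (fst z) \<inter> ?E (snd z)"
  have c: "?c \<ge> 0" using lam_pos v_pos L by simp
  have fJ: "finite J'" "finite (J - J')" using J finite_subset by auto
  have A: "?A1 \<in> sets borel" "?A2 \<in> sets borel" by (intro borel_Times; simp)+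
  have R: "3 * L * \<rho> \<ge> 0" using L \<rho> by simp
  have ev: "?B1 \<in> events" "?B2 \<in> events" "?U \<in> events" "\<And>y. ?E y \<in> events"
    using fJ Y(3) Y'(3) A Z_hit_event crossing_event by (auto intro!: sets.Int sets.finite_UN)
  have B1: "prob ?B1 \<le> ?c * b"
  proof -
    have e: "emeasure m (pre n ?A1) \<le> ennreal (?c * tail (\<rho> * a ^ n))" for n
      using emeasure_pre_ball_tail_le[OF R \<rho>, of n x] \<rho> by simp
    have "prob ?B1 \<le> (\<Sum>n\<in>J'. measure m (pre n ?A1))"
      using c tail_nonneg by (intro prob_Z_hit_le fJ A measure_pre_le[OF e]) simp
    also have "\<dots> \<le> (\<Sum>n\<in>J'. ?c * tail (\<rho> * a ^ n))"
      using c tail_nonneg by (intro sum_mono measure_pre_le[OF e]) simp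
    also have "\<dots> \<le> ?c * b"
      unfolding sum_distrib_left[symmetric] using old c by (rule mult_left_mono)
    finally show ?thesis .
  qed
  have B2: "prob ?B2 \<le> ?c * real k"
  proof -
    \<comment> \<open>Seen from a new scale the region has radius at most \<open>3 * L\<close>, so
      its intensity is bounded whatever the radii of the balls are.\<close>
    have e: "emeasure m (pre n ?A2) \<le> ennreal ?c" if "n \<in> J - J'" for n
    proof -
      have "emeasure m (pre n ?A2) \<le> ennreal (lam * v * (3 * L * \<rho> * a ^ n) ^ DIM('a))"
        by (rule emeasure_pre_ball_UNIV_le[OF R])
      also have "\<dots> \<le> ennreal ?c"
      proof (intro ennreal_leI mult_left_mono power_mono)
        show "3 * L * \<rho> * a ^ n \<le> 3 * L"
          using mult_left_mono[OF new(1)[OF that], of "3 * L"] L by (simp add: mult.assoc)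
      qed (use L \<rho> lam_pos v_pos a_gt_1 in auto)
      finally show ?thesis .
    qed
    have "prob ?B2 \<le> (\<Sum>n\<in>J - J'. measure m (pre n ?A2))"
      using c by (intro prob_Z_hit_le fJ A measure_pre_le[OF e])
    also have "\<dots> \<le> (\<Sum>n\<in>J - J'. ?c)"
      using c by (intro sum_mono measure_pre_le[OF e])
    also have "\<dots> \<le> ?c * real k"
      using new(2) c by (simp add: mult.commute mult_right_mono)
    finally show ?thesis .
  qed
  have p0: "p \<ge> 0" using p[of 0] measure_nonneg order_trans by blast
  have U: "prob ?U \<le> real (card Y * card Y') * p\<^sup>2"
  proof -
    have "prob ?U \<le> (\<Sum>z\<in>Y \<times> Y'. prob (?E (fst z) \<inter> ?E (snd z)))"
      using ev Y(3) Y'(3) by (intro measure_UNION_le sets.Int) auto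
    also have "\<dots> \<le> (\<Sum>z\<in>Y \<times> Y'. p\<^sup>2)"
    proof (rule sum_mono)
      fix z assume "z \<in> Y \<times> Y'"
      then have n: "norm (fst z) = L" "norm (snd z) = 2 * L" using Y(2) Y'(2) by auto
      \<comment> \<open>Before scaling the centres are at least \<open>L\<close> apart, so
        \<open>6 \<le> L\<close> separates the two balls of radius
        \<open>3 * \<rho>\<close>.\<close>
      have "norm (snd z) - norm (fst z) \<le> norm (snd z - fst z)" by (rule norm_triangle_ineq2)
      then have "6 \<le> norm (snd z - fst z)" using n L by linarith
      then have "6 * \<rho> \<le> norm (\<rho> *\<^sub>R (snd z - fst z))" using \<rho> by simp
      then have d: "6 * \<rho> \<le> dist (x + \<rho> *\<^sub>R fst z) (x + \<rho> *\<^sub>R snd z)"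
        by (simp add: dist_norm norm_minus_commute scaleR_right_diff_distrib)
      have "ball (x + \<rho> *\<^sub>R fst z) (3 * \<rho>) \<inter> ball (x + \<rho> *\<^sub>R snd z) (3 * \<rho>) = {}"
        by (rule disjoint_ballI) (use d in simp)
      then have "prob (?E (fst z) \<inter> ?E (snd z)) = prob (?E (fst z)) * prob (?E (snd z))"
        by (intro prob_crossing_Int fJ \<rho>)
      also have "\<dots> \<le> p\<^sup>2"
        unfolding power2_eq_square by (intro mult_mono p p0) auto
      finally show "prob (?E (fst z) \<inter> ?E (snd z)) \<le> p\<^sup>2" .
    qed
    also have "\<dots> = real (card Y * card Y') * p\<^sup>2"
      by (simp add: card_cartesian_product)
    finally show ?thesis .
  qed
  have "{\<omega> \<in> space M. crossing (Z J \<omega>) x (L * \<rho>)} \<subseteq> ?B1 \<union> ?B2 \<union> ?U"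
  proof
    fix \<omega> assume "\<omega> \<in> {\<omega> \<in> space M. crossing (Z J \<omega>) x (L * \<rho>)}"
    then have \<omega>: "\<omega> \<in> space M" "crossing (Z J \<omega>) x (L * \<rho>)" by auto
    show "\<omega> \<in> ?B1 \<union> ?B2 \<union> ?U"
    proof (rule ccontr)
      assume n: "\<omega> \<notin> ?B1 \<union> ?B2 \<union> ?U"
      have "Z J \<omega> = Z J' \<omega> \<union> Z (J - J') \<omega>"
        unfolding scales_Un[symmetric] using J by (simp add: Un_absorb1)
      then have "(c, r) \<in> Z J' \<omega> \<and> r \<le> \<rho>" if "(c, r) \<in> Z J \<omega>" "dist x c < 3 * L * \<rho>" for c r
        using n \<omega>(1) that by auto
      then have "\<exists>y\<in>Y. \<exists>y'\<in>Y'. crossing (Z J' \<omega>) (x + \<rho> *\<^sub>R y) \<rho> \<and> crossing (Z J' \<omega>) (x + \<rho> *\<^sub>R y') \<rho>"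
        using crossing_step[OF \<omega>(2) L \<rho> Y(1,2) Y'(1,2)] by blast
      then show False using n \<omega>(1) by auto
    qed
  qed
  then have "prob {\<omega> \<in> space M. crossing (Z J \<omega>) x (L * \<rho>)} \<le> prob (?B1 \<union> ?B2 \<union> ?U)"
    using ev by (intro finite_measure_mono) auto
  also have "\<dots> \<le> prob ?B1 + prob ?B2 + prob ?U"
    using ev measure_Un_le[of "?B1 \<union> ?B2" M ?U] measure_Un_le[of ?B1 M ?B2] by fastforce
  finally show ?thesis using B1 B2 U by (simp add: distrib_left)
qed

lemma not_crossing_empty: "\<not> crossing (scales a {} X) x \<rho>"
  by (auto simp: crossing_def scales_def covered_def connected_component_def)

text \<open>Going up from radius \<open>1 / a ^ N\<close> to radius 1, each step of factor \<open>a ^ k\<close> lets in \<open>k\<close> new scales; the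
  resulting bound does not depend on \<open>N\<close>.\<close>

lemma prob_crossing_small:
  fixes k :: nat
  assumes k: "k \<ge> 1" and L: "6 \<le> a ^ k"
    and Y: "sphere (0::'a) (a ^ k) \<subseteq> (\<Union>y\<in>Y. ball y 1)" "Y \<subseteq> sphere 0 (a ^ k)" "finite Y"
    and Y': "sphere (0::'a) (2 * a ^ k) \<subseteq> (\<Union>y\<in>Y'. ball y 1)" "Y' \<subseteq> sphere 0 (2 * a ^ k)" "finite Y'"
    and S: "\<And>n. (\<Sum>j<n. tail (a ^ j)) \<le> S"
    and \<epsilon>: "\<epsilon> \<ge> 0" "real (card Y * card Y') * \<epsilon>\<^sup>2 + lam * v * (3 * a ^ k) ^ DIM('a) * (S + real k) \<le> \<epsilon>"
  shows "prob {\<omega> \<in> space M. crossing (Z {s..<N} \<omega>) x (1 / a ^ s)} \<le> \<epsilon>"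
\<comment> \<open>Larger \<open>s\<close> means smaller radius, so the hypothesis at
  \<open>s + k\<close> concerns the previous radius; for \<open>s \<ge> N\<close> no scale is left
  and nothing crosses.\<close>
proof (induction "N - s" arbitrary: s x rule: less_induct)
  case less
  show ?case
  proof (cases "s < N")
    case False
    then have "{s..<N} = {}" by simp
    then show ?thesis using \<epsilon>(1) by (simp add: not_crossing_empty)
  next
    case True
    have IH: "prob {\<omega> \<in> space M. crossing (Z {s + k..<N} \<omega>) x (1 / a ^ (s + k))} \<le> \<epsilon>" for x
      by (rule less) (use True k in simp)
    \<comment> \<open>At this radius scale \<open>n\<close> has threshold
      \<open>a ^ (n - (s + k))\<close>: the tails start again at exponent 0, which makes the bound
      uniform in \<open>s\<close>.\<close>
    have "(\<Sum>n = s + k..<N. tail (1 / a ^ (s + k) * a ^ n)) = (\<Sum>j<N - (s + k). tail (a ^ j))"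
    proof (rule sum.reindex_bij_witness[where i = "\<lambda>j. j + (s + k)" and j = "\<lambda>n. n - (s + k)"])
      fix n assume "n \<in> {s + k..<N}"
      then show "tail (a ^ (n - (s + k))) = tail (1 / a ^ (s + k) * a ^ n)"
        using a_gt_1 by (simp add: power_diff)
    qed auto
    also have "\<dots> \<le> S" by (rule S)
    finally have old: "(\<Sum>n = s + k..<N. tail (1 / a ^ (s + k) * a ^ n)) \<le> S" .
    have "prob {\<omega> \<in> space M. crossing (Z {s..<N} \<omega>) x (a ^ k * (1 / a ^ (s + k)))} \<le>
        real (card Y * card Y') * \<epsilon>\<^sup>2 + lam * v * (3 * a ^ k) ^ DIM('a) * (S + real k)"
    proof (rule prob_crossing_step[OF _ _ L _ Y Y' IH old])
      fix n assume "n \<in> {s..<N} - {s + k..<N}"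
      then have "a ^ n \<le> a ^ (s + k)" using a_gt_1 by (intro power_increasing) auto
      then show "1 / a ^ (s + k) * a ^ n \<le> 1" using a_pow_pos[of "s + k"] by simp
    next
      have "card ({s..<N} - {s + k..<N}) \<le> card {s..<s + k}" by (rule card_mono) auto
      then show "card ({s..<N} - {s + k..<N}) \<le> k" by simp
    qed (use a_gt_1 in auto)
    also have "a ^ k * (1 / a ^ (s + k)) = 1 / a ^ s"
      using a_gt_1 by (simp add: power_add)
    finally show ?thesis using \<epsilon>(2) by linarith
  qed
qed

text \<open>Above radius 1 all \<open>N\<close> scales are already present, so the step is used with
  equal scale sets and 0 new scales, and only tails from exponent \<open>k * i\<close> onwards
  remain.\<close>

lemma prob_crossing_large:
  fixes q \<tau> :: "nat \<Rightarrow> real" and k :: nat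
  assumes L: "6 \<le> a ^ k"
    and Y: "sphere (0::'a) (a ^ k) \<subseteq> (\<Union>y\<in>Y. ball y 1)" "Y \<subseteq> sphere 0 (a ^ k)" "finite Y"
    and Y': "sphere (0::'a) (2 * a ^ k) \<subseteq> (\<Union>y\<in>Y'. ball y 1)" "Y' \<subseteq> sphere 0 (2 * a ^ k)" "finite Y'"
    and \<tau>: "\<And>i n. (\<Sum>j<n. tail (a ^ (j + i))) \<le> \<tau> i"
    and q0: "\<And>x. prob {\<omega> \<in> space M. crossing (Z {..<N} \<omega>) x 1} \<le> q 0"
    and q: "\<And>i. real (card Y * card Y') * (q i)\<^sup>2 + lam * v * (3 * a ^ k) ^ DIM('a) * \<tau> (k * i) \<le> q (Suc i)"
  shows "prob {\<omega> \<in> space M. crossing (Z {..<N} \<omega>) x (a ^ (k * i))} \<le> q i"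
proof (induction i arbitrary: x)
  case 0
  then show ?case using q0 by simp
next
  case (Suc i)
  have "(\<Sum>n<N. tail (a ^ (k * i) * a ^ n)) \<le> \<tau> (k * i)"
    using \<tau>[of "k * i" N] by (simp add: power_add mult.commute)
  then have "prob {\<omega> \<in> space M. crossing (Z {..<N} \<omega>) x (a ^ k * a ^ (k * i))} \<le>
     real (card Y * card Y') * (q i)\<^sup>2 + lam * v * (3 * a ^ k) ^ DIM('a) * (\<tau> (k * i) + real 0)"
    by (intro prob_crossing_step[OF _ _ L _ Y Y' Suc]) (use a_gt_1 in auto)
  then show ?case using q[of i] by (simp add: power_add)
qed

section \<open>Passage from finitely many scales to all scales\<close>

lemma prob_UN_le:
  assumes "\<And>N. E N \<in> events" "incseq E" "\<And>N. prob (E N) \<le> b"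
  shows "prob (\<Union>N. E N) \<le> b"
proof (rule LIMSEQ_le_const2)
  show "(\<lambda>N. prob (E N)) \<longlonglongrightarrow> prob (\<Union>N. E N)"
    using assms by (intro finite_Lim_measure_incseq) auto
qed (use assms(3) in blast)

lemma incseq_Z: "incseq (\<lambda>N. Z {..<N} \<omega>)"
  by (intro monoI scales_mono) auto

text \<open>A crossing uses finitely many balls, hence finitely many scales, so continuity from
  below carries over a bound uniform in \<open>N\<close>.\<close>

lemma prob_crossing_UNIV:
  assumes "\<And>N. prob {\<omega> \<in> space M. crossing (Z {..<N} \<omega>) x \<rho>} \<le> b"
  shows "prob {\<omega> \<in> space M. crossing (Z UNIV \<omega>) x \<rho>} \<le> b"
proof -
  let ?E = "\<lambda>N. {\<omega> \<in> space M. crossing (Z {..<N} \<omega>) x \<rho>}"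
  have "\<exists>N. crossing (Z {..<N} \<omega>) x \<rho>" if cr: "crossing (Z UNIV \<omega>) x \<rho>" for \<omega>
  proof -
    let ?B = "ball x (3 * \<rho>) \<times> {..\<rho>}"
    obtain p q where pq: "p \<in> cball x \<rho>" "q \<in> - ball x (2 * \<rho>)"
        "connected_component (covered (Z UNIV \<omega> \<inter> ?B)) p q"
      using cr unfolding crossing_def by blast
    have eq: "Z UNIV \<omega> \<inter> ?B = (\<Union>N. Z {..<N} \<omega> \<inter> ?B)"
      unfolding scales_UNIV by blast
    have "incseq (\<lambda>N. Z {..<N} \<omega> \<inter> ?B)"
      by (intro monoI Int_mono incseqD[OF incseq_Z] order_refl)
    then obtain N where "connected_component (covered (Z {..<N} \<omega> \<inter> ?B)) p q"
      using connected_component_incseq pq(3) unfolding eq by blast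
    then show ?thesis using pq unfolding crossing_def by blast
  qed
  moreover have "crossing (Z UNIV \<omega>) x \<rho>" if "crossing (Z {..<N} \<omega>) x \<rho>" for N \<omega>
    using that by (rule crossing_mono[rotated]) (intro scales_mono, simp)
  ultimately have eq: "{\<omega> \<in> space M. crossing (Z UNIV \<omega>) x \<rho>} = (\<Union>N. ?E N)" by blast
  have "?E N \<subseteq> ?E N'" if "N \<le> N'" for N N'
    using crossing_mono[OF incseqD[OF incseq_Z that]] by blast
  then have "incseq ?E" by (rule monoI)
  then show ?thesis unfolding eq by (intro prob_UN_le crossing_event assms)
qed

text \<open>A ball \<open>(c, r)\<close> in \<open>cone (1 / 2) s\<close> contains \<open>ball 0 (s / 2)\<close>, and a ball of radius larger than \<open>s\<close>
  that meets \<open>ball 0 (2 * s)\<close> belongs to \<open>cone 3 s\<close>.\<close>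

definition cone :: "real \<Rightarrow> real \<Rightarrow> ('a \<times> real) set" where
  "cone \<alpha> s = {(c, r). norm c < \<alpha> * r \<and> s < r}"

lemma borel_cone: "cone \<alpha> s \<in> sets borel"
proof -
  have "open {p :: 'a \<times> real. norm (fst p) < \<alpha> * snd p \<and> s < snd p}"
    by (intro open_Collect_conj open_Collect_less continuous_intros)
  moreover have "cone \<alpha> s = {p. norm (fst p) < \<alpha> * snd p \<and> s < snd p}"
    by (auto simp: cone_def)
  ultimately show ?thesis by simp
qed

lemma pre_cone: "pre n (cone \<alpha> s) = {(c, r) \<in> space m. norm c < \<alpha> * r \<and> s * a ^ n < r}"
proof -
  have "norm ((1 / a ^ n) *\<^sub>R c) < \<alpha> * (r / a ^ n) \<longleftrightarrow> norm c < \<alpha> * r" for c :: 'a and r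
    using a_gt_1 by (simp add: divide_less_cancel)
  moreover have "s < r / a ^ n \<longleftrightarrow> s * a ^ n < r" for r
    using a_pow_pos[of n] by (simp add: pos_less_divide_eq)
  ultimately show ?thesis unfolding pre_def cone_def by auto
qed

text \<open>Slicing by radius, each \<open>r\<close> above the threshold contributes the volume of a
  ball of radius \<open>\<alpha> * r\<close>. Being an equality, it serves both the upper bound in
  the convergent case and the divergence argument.\<close>

lemma emeasure_pre_cone:
  assumes "\<alpha> \<ge> 0"
  shows "emeasure m (pre n (cone \<alpha> s)) = ennreal (lam * v * \<alpha> ^ DIM('a) * tail (s * a ^ n))"
proof -
  interpret N: prob_space \<nu> by (rule prob_\<nu>)
  interpret L: sigma_finite_measure "scale_measure (ennreal lam) (lborel :: 'a measure)"
  proof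
    obtain A :: "'a set set" where A: "countable A" "A \<subseteq> sets lborel" "\<Union>A = space lborel"
        "\<forall>a\<in>A. emeasure lborel a \<noteq> \<infinity>"
      using lborel.sigma_finite_countable by blast
    then show "\<exists>A. countable A \<and> A \<subseteq> sets (scale_measure (ennreal lam) (lborel :: 'a measure)) \<and>
        \<Union>A = space (scale_measure (ennreal lam) (lborel :: 'a measure)) \<and>
        (\<forall>a\<in>A. emeasure (scale_measure (ennreal lam) lborel) a \<noteq> \<infinity>)"
      by (intro exI[of _ A]) (auto simp: space_scale_measure ennreal_mult_eq_top_iff)
  qed
  interpret P: pair_sigma_finite "scale_measure (ennreal lam) (lborel :: 'a measure)" \<nu> ..
  have "emeasure m (pre n (cone \<alpha> s)) =
      (\<integral>\<^sup>+r. emeasure (scale_measure (ennreal lam) lborel) ((\<lambda>c. (c, r)) -` pre n (cone \<alpha> s)) \<partial>\<nu>)"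
    using sets_pre[OF borel_cone] unfolding boolean_intensity_def by (rule P.emeasure_pair_measure_alt2)
  also have "\<dots> = (\<integral>\<^sup>+r. ennreal (lam * v * \<alpha> ^ DIM('a)) * (ennreal (r ^ DIM('a)) * indicator {s * a ^ n<..} r) \<partial>\<nu>)"
  proof (rule nn_integral_cong)
    fix r assume "r \<in> space \<nu>"
    then have r: "r > 0" by (simp add: space_\<nu>)
    show "emeasure (scale_measure (ennreal lam) lborel) ((\<lambda>c. (c, r)) -` pre n (cone \<alpha> s)) =
        ennreal (lam * v * \<alpha> ^ DIM('a)) * (ennreal (r ^ DIM('a)) * indicator {s * a ^ n<..} r)"
    proof (cases "s * a ^ n < r")
      case True
      then have "(\<lambda>c. (c, r)) -` pre n (cone \<alpha> s) = ball 0 (\<alpha> * r)"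
        using r by (auto simp: pre_cone space_m)
      then have "emeasure (scale_measure (ennreal lam) lborel) ((\<lambda>c. (c, r)) -` pre n (cone \<alpha> s)) =
          ennreal lam * ennreal (v * (\<alpha> * r) ^ DIM('a))"
        using r assms by (simp add: emeasure_ball v_def)
      also have "\<dots> = ennreal (lam * v * \<alpha> ^ DIM('a) * r ^ DIM('a))"
        using lam_pos by (simp add: ennreal_mult'[symmetric] power_mult_distrib mult.assoc)
      also have "\<dots> = ennreal (lam * v * \<alpha> ^ DIM('a)) * ennreal (r ^ DIM('a))"
        using r by (intro ennreal_mult'') simp
      finally show ?thesis using True by simp
    next
      case False
      then have "(\<lambda>c. (c, r)) -` pre n (cone \<alpha> s) = {}" by (auto simp: pre_cone)
      then show ?thesis using False by simp
    qed
  qed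
  also have "\<dots> = ennreal (lam * v * \<alpha> ^ DIM('a)) * ennreal (tail (s * a ^ n))"
    unfolding ennreal_tail
  proof (rule nn_integral_cmult)
    have "(\<lambda>r::real. ennreal (r ^ DIM('a)) * indicator {s * a ^ n<..} r) \<in> borel_measurable borel"
      by measurable
    then show "(\<lambda>r. ennreal (r ^ DIM('a)) * indicator {s * a ^ n<..} r) \<in> borel_measurable \<nu>"
      by (rule measurable_compose[OF measurable_id_\<nu>])
  qed
  also have "\<dots> = ennreal (lam * v * \<alpha> ^ DIM('a) * tail (s * a ^ n))"
    by (rule ennreal_mult''[symmetric, OF tail_nonneg])
  finally show ?thesis .
qed

lemma measure_pre_cone:
  assumes "\<alpha> \<ge> 0"
  shows "measure m (pre n (cone \<alpha> s)) = lam * v * \<alpha> ^ DIM('a) * tail (s * a ^ n)"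
  unfolding measure_def emeasure_pre_cone[OF assms]
  using assms lam_pos v_pos tail_nonneg by simp

lemma prob_hit_cone_le:
  assumes "\<alpha> \<ge> 0" "\<And>N. (\<Sum>n<N. tail (s * a ^ n)) \<le> \<tau>"
  shows "prob {\<omega> \<in> space M. Z UNIV \<omega> \<inter> cone \<alpha> s \<noteq> {}} \<le> lam * v * \<alpha> ^ DIM('a) * \<tau>"
proof -
  let ?E = "\<lambda>N. {\<omega> \<in> space M. Z {..<N} \<omega> \<inter> cone \<alpha> s \<noteq> {}}"
  have "{\<omega> \<in> space M. Z UNIV \<omega> \<inter> cone \<alpha> s \<noteq> {}} = (\<Union>N. ?E N)"
    unfolding scales_UNIV by blast
  also have "prob (\<Union>N. ?E N) \<le> lam * v * \<alpha> ^ DIM('a) * \<tau>"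
  proof (rule prob_UN_le)
    show "incseq ?E"
    proof (rule monoI)
      fix N N' :: nat assume "N \<le> N'"
      then show "?E N \<subseteq> ?E N'" using incseqD[OF incseq_Z] by blast
    qed
    fix N
    show "?E N \<in> events" by (rule Z_hit_event[OF borel_cone])
    have "prob (?E N) \<le> (\<Sum>n<N. measure m (pre n (cone \<alpha> s)))"
      by (intro prob_Z_hit_le borel_cone) (simp_all add: emeasure_pre_cone assms)
    also have "\<dots> = lam * v * \<alpha> ^ DIM('a) * (\<Sum>n<N. tail (s * a ^ n))"
      using assms(1) by (simp add: measure_pre_cone sum_distrib_left)
    also have "\<dots> \<le> lam * v * \<alpha> ^ DIM('a) * \<tau>"
      using assms lam_pos v_pos by (intro mult_left_mono) auto
    finally show "prob (?E N) \<le> lam * v * \<alpha> ^ DIM('a) * \<tau>" .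
  qed
  finally show ?thesis .
qed

section \<open>The moment condition\<close>

text \<open>After exchanging sum and integral, each radius is counted once for every power of
  \<open>a\<close> below it.\<close>

lemma suminf_tail:
  "(\<Sum>j. ennreal (tail (a ^ j))) = (\<integral>\<^sup>+ r. ennreal (r ^ DIM('a)) * of_nat (nat \<lceil>log a r\<rceil>) \<partial>\<nu>)"
proof -
  have "(\<lambda>r::real. ennreal (r ^ DIM('a)) * indicator {a ^ j<..} r) \<in> borel_measurable \<nu>" for j
  proof -
    have "(\<lambda>r::real. ennreal (r ^ DIM('a)) * indicator {a ^ j<..} r) \<in> borel_measurable borel"
      by measurable
    then show ?thesis by (rule measurable_compose[OF measurable_id_\<nu>])
  qed
  then have "(\<Sum>j. ennreal (tail (a ^ j))) =
      (\<integral>\<^sup>+ r. (\<Sum>j. ennreal (r ^ DIM('a)) * indicator {a ^ j<..} r) \<partial>\<nu>)"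
    unfolding ennreal_tail by (rule nn_integral_suminf[symmetric])
  also have "\<dots> = (\<integral>\<^sup>+ r. ennreal (r ^ DIM('a)) * of_nat (nat \<lceil>log a r\<rceil>) \<partial>\<nu>)"
    using a_gt_1 by (intro nn_integral_cong) (simp add: space_\<nu> suminf_indicator_powers)
  finally show ?thesis .
qed

text \<open>For \<open>r \<ge> 1\<close> the integer count exceeds \<open>ln r / ln a\<close> by
  less than 1, and \<open>moment\<close> absorbs this excess; for \<open>r < 1\<close> the count is
  0.\<close>

lemma summable_tail_iff:
  "summable (\<lambda>j. tail (a ^ j)) \<longleftrightarrow> (\<integral>\<^sup>+ \<beta>\<in>{1..}. ennreal (\<beta> ^ DIM('a) * ln \<beta>) \<partial>\<nu>) < \<infinity>"
proof -
  let ?X = "\<integral>\<^sup>+ r. ennreal (r ^ DIM('a)) * of_nat (nat \<lceil>log a r\<rceil>) \<partial>\<nu>"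
  let ?I = "\<integral>\<^sup>+ \<beta>\<in>{1..}. ennreal (\<beta> ^ DIM('a) * ln \<beta>) \<partial>\<nu>"
  let ?M = "\<integral>\<^sup>+ r. ennreal (r ^ DIM('a)) \<partial>\<nu>"
  have la: "ln a > 0" using a_gt_1 by simp
  have summable_iff: "summable (\<lambda>j. tail (a ^ j)) \<longleftrightarrow> ?X < \<infinity>"
  proof
    assume "summable (\<lambda>j. tail (a ^ j))"
    then show "?X < \<infinity>"
      using suminf_ennreal2[OF tail_nonneg, of "\<lambda>j. a ^ j"] by (simp add: suminf_tail)
  next
    assume "?X < \<infinity>"
    then show "summable (\<lambda>j. tail (a ^ j))"
      using tail_nonneg by (intro summable_suminf_not_top) (auto simp: suminf_tail)
  qed
  have meas: "(\<lambda>r. ennreal (r ^ DIM('a))) \<in> borel_measurable \<nu>"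
  proof -
    have "(\<lambda>r::real. ennreal (r ^ DIM('a))) \<in> borel_measurable borel" by measurable
    then show ?thesis by (rule measurable_compose[OF measurable_id_\<nu>])
  qed
  have meas2: "(\<lambda>r. ennreal (r ^ DIM('a) * ln r) * indicator {1..} r) \<in> borel_measurable \<nu>"
  proof -
    have "(\<lambda>r::real. ennreal (r ^ DIM('a) * ln r) * indicator {1..} r) \<in> borel_measurable borel"
      by measurable
    then show ?thesis by (rule measurable_compose[OF measurable_id_\<nu>])
  qed
  have meas3: "(\<lambda>r. ennreal (r ^ DIM('a)) * of_nat (nat \<lceil>log a r\<rceil>)) \<in> borel_measurable \<nu>"
  proof -
    have "(\<lambda>r::real. ennreal (r ^ DIM('a)) * of_nat (nat \<lceil>log a r\<rceil>)) \<in> borel_measurable borel"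
      by measurable
    then show ?thesis by (rule measurable_compose[OF measurable_id_\<nu>])
  qed
  have "?X \<le> (\<integral>\<^sup>+ r. ennreal (r ^ DIM('a)) + ennreal (1 / ln a) * (ennreal (r ^ DIM('a) * ln r) * indicator {1..} r) \<partial>\<nu>)"
  proof (rule nn_integral_mono)
    fix r assume "r \<in> space \<nu>"
    then have r: "r > 0" by (simp add: space_\<nu>)
    show "ennreal (r ^ DIM('a)) * of_nat (nat \<lceil>log a r\<rceil>) \<le>
      ennreal (r ^ DIM('a)) + ennreal (1 / ln a) * (ennreal (r ^ DIM('a) * ln r) * indicator {1..} r)"
    proof (cases "r \<ge> 1")
      case True
      then have l: "log a r \<ge> 0" using a_gt_1 by simp
      have "real (nat \<lceil>log a r\<rceil>) \<le> 1 + 1 / ln a * ln r"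
        using l by (simp add: log_def) linarith
      then have "r ^ DIM('a) * real (nat \<lceil>log a r\<rceil>) \<le> r ^ DIM('a) * (1 + 1 / ln a * ln r)"
        using r by (intro mult_left_mono) auto
      also have "\<dots> = r ^ DIM('a) + 1 / ln a * (r ^ DIM('a) * ln r)"
        by (simp add: algebra_simps)
      finally have "ennreal (r ^ DIM('a) * real (nat \<lceil>log a r\<rceil>)) \<le>
          ennreal (r ^ DIM('a) + 1 / ln a * (r ^ DIM('a) * ln r))" by (rule ennreal_leI)
      also have "\<dots> = ennreal (r ^ DIM('a)) + ennreal (1 / ln a) * ennreal (r ^ DIM('a) * ln r)"
        using r True la by (simp add: ennreal_plus ennreal_mult'[symmetric])
      finally show ?thesis
        using True r by (simp add: ennreal_mult' ennreal_of_nat_eq_real_of_nat)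
    next
      case False
      then have "log a r < 0" using r a_gt_1 by simp
      then have "nat \<lceil>log a r\<rceil> = 0" by linarith
      then show ?thesis by simp
    qed
  qed
  also have "\<dots> = ?M + ennreal (1 / ln a) * ?I"
    using meas meas2 by (simp add: nn_integral_add nn_integral_cmult)
  finally have X: "?X \<le> ?M + ennreal (1 / ln a) * ?I" .
  have "?I \<le> (\<integral>\<^sup>+ r. ennreal (ln a) * (ennreal (r ^ DIM('a)) * of_nat (nat \<lceil>log a r\<rceil>)) \<partial>\<nu>)"
  proof (rule nn_integral_mono)
    fix r assume "r \<in> space \<nu>"
    then have r: "r > 0" by (simp add: space_\<nu>)
    have "ln r = ln a * log a r" using la by (simp add: log_def)
    also have "\<dots> \<le> ln a * real (nat \<lceil>log a r\<rceil>)"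
      using la by (intro mult_left_mono) linarith+
    finally have "r ^ DIM('a) * ln r \<le> ln a * (r ^ DIM('a) * real (nat \<lceil>log a r\<rceil>))"
      using r mult_left_mono[of "ln r" "ln a * real (nat \<lceil>log a r\<rceil>)" "r ^ DIM('a)"] by (simp add: mult.left_commute)
    then have "ennreal (r ^ DIM('a) * ln r) \<le> ennreal (ln a * (r ^ DIM('a) * real (nat \<lceil>log a r\<rceil>)))"
      by (rule ennreal_leI)
    also have "\<dots> = ennreal (ln a) * (ennreal (r ^ DIM('a)) * of_nat (nat \<lceil>log a r\<rceil>))"
      using la r by (simp add: ennreal_mult' ennreal_of_nat_eq_real_of_nat)
    finally show "ennreal (r ^ DIM('a) * ln r) * indicator {1..} r \<le>
        ennreal (ln a) * (ennreal (r ^ DIM('a)) * of_nat (nat \<lceil>log a r\<rceil>))"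
      by (auto simp: indicator_def)
  qed
  also have "\<dots> = ennreal (ln a) * ?X"
    using meas3 by (rule nn_integral_cmult)
  finally have I: "?I \<le> ennreal (ln a) * ?X" .
  show ?thesis
    unfolding summable_iff
  proof
    assume "?X < \<infinity>"
    then have "ennreal (ln a) * ?X < \<infinity>" by (simp add: ennreal_mult_less_top)
    then show "?I < \<infinity>" using I by (rule order_le_less_trans[rotated])
  next
    assume "?I < \<infinity>"
    then have "?M + ennreal (1 / ln a) * ?I < \<infinity>"
      using moment by (simp add: ennreal_mult_less_top)
    then show "?X < \<infinity>" using X by (rule order_le_less_trans[rotated])
  qed
qed

section \<open>The component of the origin\<close>

text \<open>Integer radii turn boundedness into a countable combination of connection events, hence
  a measurable one.\<close>

lemma bounded_component_iff:
  "bounded (origin_component X) \<longleftrightarrow>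
    (\<exists>N::nat. \<not> (\<exists>p\<in>{0}. \<exists>q\<in>- ball 0 (real N). connected_component (covered X) p q))"
  for X :: "('a \<times> real) set"
proof -
  have sub_iff: "\<not> (\<exists>p\<in>{0}. \<exists>q\<in>- ball 0 R. connected_component (covered X) p q) \<longleftrightarrow>
      origin_component X \<subseteq> ball 0 R" for R
    unfolding origin_component_def by (auto simp: subset_eq simp del: mem_ball)
  show ?thesis
    unfolding sub_iff
  proof
    assume "bounded (origin_component X)"
    then obtain R where R: "origin_component X \<subseteq> ball 0 R" using bounded_subset_ballD by blast
    obtain N :: nat where "R \<le> real N" using real_arch_simple by blast
    then show "\<exists>N::nat. origin_component X \<subseteq> ball 0 (real N)"
      using order_trans[OF R subset_ball] by blast
  next
    assume "\<exists>N::nat. origin_component X \<subseteq> ball 0 (real N)"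
    then show "bounded (origin_component X)" using bounded_subset[OF bounded_ball] by blast
  qed
qed

lemma bounded_component_event: "{\<omega> \<in> space M. bounded (origin_component (Z J \<omega>))} \<in> events"
  unfolding bounded_component_iff
  by (intro sets.sets_Collect_countable_Ex sets.sets_Collect_neg
      connected_component_measurable[OF sets.sigma_algebra_axioms Z_hit_event])

text \<open>A ball with \<open>r > \<rho>\<close> touching \<open>ball 0 (2 * \<rho>)\<close> has
  \<open>norm c < 2 * \<rho> + r < 3 * r\<close>, so it belongs to \<open>cone 3 \<rho>\<close>;
  excluding that cone gives the smallness hypothesis of \<open>crossingI\<close>.\<close>

lemma unbounded_imp_crossing:
  assumes "\<not> bounded (origin_component X)" "\<rho> > 0" "X \<inter> cone 3 \<rho> = {}"
  shows "crossing X 0 \<rho>"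
proof -
  have "\<not> origin_component X \<subseteq> ball 0 (2 * \<rho>)"
  proof
    assume "origin_component X \<subseteq> ball 0 (2 * \<rho>)"
    then have "bounded (origin_component X)" by (rule bounded_subset[OF bounded_ball])
    then show False using assms(1) by simp
  qed
  then obtain q where q: "q \<in> origin_component X" "q \<notin> ball 0 (2 * \<rho>)" by blast
  have "0 \<in> covered X"
    using q(1) connected_component_in[of "covered X" 0 q] unfolding origin_component_def by simp
  then have "0 \<in> origin_component X"
    unfolding origin_component_def by simp
  show ?thesis
  proof (rule crossingI[where C = "origin_component X" and p = 0 and q = q])
    show "connected (origin_component X)" "origin_component X \<subseteq> covered X"
      unfolding origin_component_def
      by (rule connected_connected_component, rule connected_component_subset)
    fix c r assume cr: "(c, r) \<in> X" "dist 0 c < 2 * \<rho> + r"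
    show "r \<le> \<rho>"
    proof (rule ccontr)
      assume "\<not> r \<le> \<rho>"
      then have "(c, r) \<in> cone 3 \<rho>" using cr(2) by (simp add: cone_def)
      then show False using cr(1) assms(3) by blast
    qed
  qed (use q assms(2) \<open>0 \<in> origin_component X\<close> in auto)
qed

lemma prob_bounded_eq_1:
  fixes k :: nat
  assumes sum: "summable (\<lambda>j. tail (a ^ j))"
    and k: "k \<ge> 1" and L: "6 \<le> a ^ k"
    and Y: "sphere (0::'a) (a ^ k) \<subseteq> (\<Union>y\<in>Y. ball y 1)" "Y \<subseteq> sphere 0 (a ^ k)" "finite Y"
    and Y': "sphere (0::'a) (2 * a ^ k) \<subseteq> (\<Union>y\<in>Y'. ball y 1)" "Y' \<subseteq> sphere 0 (2 * a ^ k)" "finite Y'"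
    and small: "lam * (4 * real (card Y * card Y') * v * (3 * a ^ k) ^ DIM('a) * ((\<Sum>j. tail (a ^ j)) + real k)) \<le> 1"
  shows "prob {\<omega> \<in> space M. bounded (origin_component (Z UNIV \<omega>))} = 1"
proof -
  define K where "K = real (card Y * card Y')"
  define c where "c = lam * v * (3 * a ^ k) ^ DIM('a)"
  define \<tau> where "\<tau> i = (\<Sum>j. tail (a ^ (j + i)))" for i
  define S where "S = (\<Sum>j. tail (a ^ j))"
  \<comment> \<open>Twice the inhomogeneous term, which thus takes up one half of \<epsilon>; by
    \<open>sq\<close> the quadratic term takes at most the other half.\<close>
  define \<epsilon> where "\<epsilon> = 2 * c * (S + real k)"
  \<comment> \<open>For \<open>0 \<le> x \<le> \<epsilon>\<close> the quadratic term is at most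
    \<open>x / 2\<close>, so this linear recursion is a majorant.\<close>
  define q where "q = rec_nat \<epsilon> (\<lambda>i x. x / 2 + c * \<tau> (k * i))"
  have q0: "q 0 = \<epsilon>" and qS: "q (Suc i) = q i / 2 + c * \<tau> (k * i)" for i
    by (simp_all add: q_def)
  have c0: "c \<ge> 0" using lam_pos v_pos a_gt_1 by (simp add: c_def)
  have K0: "K \<ge> 0" by (simp add: K_def)
  have sum_shift: "summable (\<lambda>j. tail (a ^ (j + i)))" for i
    using summable_ignore_initial_segment[OF sum] .
  have \<tau>_partial: "(\<Sum>j<n. tail (a ^ (j + i))) \<le> \<tau> i" for i n
    unfolding \<tau>_def by (intro sum_le_suminf sum_shift) (auto simp: tail_nonneg)
  have \<tau>0: "\<tau> i \<ge> 0" for i unfolding \<tau>_def by (intro suminf_nonneg sum_shift tail_nonneg)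
  have \<tau>S: "\<tau> i \<le> S" for i
  proof -
    have "S = \<tau> i + (\<Sum>j<i. tail (a ^ j))"
      unfolding S_def \<tau>_def by (rule suminf_split_initial_segment[OF sum])
    moreover have "(\<Sum>j<i. tail (a ^ j)) \<ge> 0" by (intro sum_nonneg tail_nonneg)
    ultimately show ?thesis by linarith
  qed
  have S0: "S \<ge> 0" using \<tau>0[of 0] \<tau>S[of 0] by linarith
  \<comment> \<open>The factor 4 in \<open>small\<close> combines the 2 in the definition of
    \<epsilon> with the target \<open>1 / 2\<close>.\<close>
  have K\<epsilon>: "K * \<epsilon> \<le> 1 / 2"
  proof -
    have "x * (4 * K * y * P * T) = 2 * (K * (2 * (x * y * P) * T))" for x y P T :: real
      by algebra
    then have "2 * (K * \<epsilon>) = lam * (4 * K * v * (3 * a ^ k) ^ DIM('a) * (S + real k))"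
      unfolding \<epsilon>_def c_def by metis
    then show ?thesis using small unfolding K_def S_def by linarith
  qed
  have \<epsilon>0: "\<epsilon> \<ge> 0" using c0 S0 by (simp add: \<epsilon>_def)
  have sq: "K * x\<^sup>2 \<le> x / 2" if "0 \<le> x" "x \<le> \<epsilon>" for x
  proof -
    have "K * x \<le> 1 / 2" using mult_left_mono[OF that(2) K0] K\<epsilon> by linarith
    from mult_right_mono[OF this that(1)] show ?thesis by (simp add: power2_eq_square)
  qed
  have q_bounds: "0 \<le> q i \<and> q i \<le> \<epsilon>" for i
  proof (induction i)
    case 0
    then show ?case using \<epsilon>0 by (simp add: q0)
  next
    case (Suc i)
    have "c * \<tau> (k * i) \<le> c * (S + real k)" using \<tau>S[of "k * i"] c0 by (intro mult_left_mono) auto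
    moreover have "0 \<le> c * \<tau> (k * i)" using c0 \<tau>0 by simp
    moreover have "\<epsilon> = 2 * (c * (S + real k))" by (simp add: \<epsilon>_def)
    ultimately show ?case using Suc unfolding qS by linarith
  qed
  have \<epsilon>_step: "real (card Y * card Y') * \<epsilon>\<^sup>2 + lam * v * (3 * a ^ k) ^ DIM('a) * (S + real k) \<le> \<epsilon>"
    using sq[of \<epsilon>] \<epsilon>0 unfolding K_def[symmetric] c_def[symmetric] by (simp add: \<epsilon>_def)
  have S_partial: "(\<Sum>j<n. tail (a ^ j)) \<le> S" for n
    using \<tau>_partial[of 0 n] \<tau>S[of 0] by simp
  have base: "prob {\<omega> \<in> space M. crossing (Z {..<N} \<omega>) x 1} \<le> q 0" for x N
    using prob_crossing_small[OF k L Y Y' S_partial \<epsilon>0 \<epsilon>_step, of 0 N x]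
    by (simp add: q0 atLeast0LessThan)
  have q_step: "real (card Y * card Y') * (q i)\<^sup>2 + lam * v * (3 * a ^ k) ^ DIM('a) * \<tau> (k * i) \<le> q (Suc i)" for i
    using sq[of "q i"] q_bounds[of i] unfolding K_def[symmetric] c_def[symmetric] qS by simp
  have cross: "prob {\<omega> \<in> space M. crossing (Z UNIV \<omega>) 0 (a ^ (k * i))} \<le> q i" for i
    by (intro prob_crossing_UNIV prob_crossing_large[OF L Y Y' \<tau>_partial base q_step])
  have far: "prob {\<omega> \<in> space M. Z UNIV \<omega> \<inter> cone 3 (a ^ (k * i)) \<noteq> {}} \<le> lam * v * 3 ^ DIM('a) * \<tau> (k * i)" for i
  proof (rule prob_hit_cone_le)
    show "(\<Sum>n<N. tail (a ^ (k * i) * a ^ n)) \<le> \<tau> (k * i)" for N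
      using \<tau>_partial[of "k * i" N] by (simp add: power_add mult.commute)
  qed simp
  let ?B = "{\<omega> \<in> space M. bounded (origin_component (Z UNIV \<omega>))}"
  \<comment> \<open>At every radius an unbounded component causes a crossing or a hit of the cone,
    and both bounds vanish as \<open>i\<close> grows.\<close>
  have le: "prob (space M - ?B) \<le> q i + lam * v * 3 ^ DIM('a) * \<tau> (k * i)" for i
  proof -
    let ?C = "{\<omega> \<in> space M. crossing (Z UNIV \<omega>) 0 (a ^ (k * i))}"
    let ?D = "{\<omega> \<in> space M. Z UNIV \<omega> \<inter> cone 3 (a ^ (k * i)) \<noteq> {}}"
    have ev: "?C \<in> events" "?D \<in> events" by (rule crossing_event Z_hit_event borel_cone)+
    have "space M - ?B \<subseteq> ?C \<union> ?D"
    proof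
      fix \<omega> assume "\<omega> \<in> space M - ?B"
      then have "\<omega> \<in> space M" "\<not> bounded (origin_component (Z UNIV \<omega>))" by auto
      then show "\<omega> \<in> ?C \<union> ?D"
        using unbounded_imp_crossing[of "Z UNIV \<omega>" "a ^ (k * i)", OF _ a_pow_pos] by auto
    qed
    then have "prob (space M - ?B) \<le> prob (?C \<union> ?D)"
      using ev by (intro finite_measure_mono) auto
    also have "\<dots> \<le> prob ?C + prob ?D" by (rule measure_Un_le[OF ev])
    finally show ?thesis using cross[of i] far[of i] by linarith
  qed
  have \<tau>_lim: "(\<lambda>i. \<tau> (k * i)) \<longlonglongrightarrow> 0"
  proof -
    have "\<tau> \<longlonglongrightarrow> 0" unfolding \<tau>_def by (rule suminf_exist_split2[OF sum])
    moreover have "strict_mono (\<lambda>i. k * i)" using k by (intro strict_monoI) simp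
    ultimately show ?thesis using LIMSEQ_subseq_LIMSEQ[of \<tau> 0 "\<lambda>i. k * i"] by (simp add: o_def)
  qed
  have "q \<longlonglongrightarrow> 0"
    by (rule half_recursion_tendsto_0[OF qS tendsto_mult_right_zero[OF \<tau>_lim]])
  then have "(\<lambda>i. q i + lam * v * 3 ^ DIM('a) * \<tau> (k * i)) \<longlonglongrightarrow> 0"
    using tendsto_add[OF _ tendsto_mult_right_zero[OF \<tau>_lim], of q 0 "lam * v * 3 ^ DIM('a)"] by simp
  then have "prob (space M - ?B) \<le> 0"
    by (rule LIMSEQ_le_const) (use le in blast)
  then show ?thesis
    using prob_compl[OF bounded_component_event[of UNIV]] prob_le_1[of ?B] by linarith
qed

text \<open>If the probability \<open>p\<close> were positive, comparing it with the exponential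
  void probability of the first \<open>N\<close> scales would bound all partial sums of the tails by
  \<open>- ln p / c\<close>, forcing summability.\<close>

lemma prob_no_cone:
  assumes "\<not> summable (\<lambda>j. tail (a ^ j))"
  shows "prob {\<omega> \<in> space M. Z UNIV \<omega> \<inter> cone (1 / 2) (a ^ i) = {}} = 0"
proof (rule ccontr)
  let ?p = "prob {\<omega> \<in> space M. Z UNIV \<omega> \<inter> cone (1 / 2) (a ^ i) = {}}"
  define c where "c = lam * v * (1 / 2) ^ DIM('a)"
  have c: "c > 0" using lam_pos v_pos by (simp add: c_def)
  assume "?p \<noteq> 0"
  then have p: "?p > 0" by (simp add: zero_less_measure_iff)
  have "(\<Sum>n<N. tail (a ^ (n + i))) \<le> - ln ?p / c" for N
  proof -
    have "?p \<le> prob {\<omega> \<in> space M. Z {..<N} \<omega> \<inter> cone (1 / 2) (a ^ i) = {}}"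
    proof (intro finite_measure_mono Z_void_event borel_cone)
      have "Z {..<N} \<omega> \<subseteq> Z UNIV \<omega>" for \<omega> by (rule scales_mono) simp
      then show "{\<omega> \<in> space M. Z UNIV \<omega> \<inter> cone (1 / 2) (a ^ i) = {}} \<subseteq>
          {\<omega> \<in> space M. Z {..<N} \<omega> \<inter> cone (1 / 2) (a ^ i) = {}}"
        by (intro Collect_mono conj_mono imp_refl impI) blast
    qed
    also have "\<dots> = exp (- (\<Sum>n<N. measure m (pre n (cone (1 / 2) (a ^ i)))))"
      by (intro prob_Z_void borel_cone) (simp_all add: emeasure_pre_cone)
    also have "(\<Sum>n<N. measure m (pre n (cone (1 / 2) (a ^ i)))) = c * (\<Sum>n<N. tail (a ^ (n + i)))"
      by (simp add: measure_pre_cone c_def sum_distrib_left power_add mult.commute[of "a ^ i"])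
    finally have "?p \<le> exp (- (c * (\<Sum>n<N. tail (a ^ (n + i)))))" .
    then have "ln ?p \<le> ln (exp (- (c * (\<Sum>n<N. tail (a ^ (n + i))))))"
      by (rule ln_mono[OF _ p])
    then have "ln ?p \<le> - (c * (\<Sum>n<N. tail (a ^ (n + i))))"
      unfolding ln_exp .
    then have "c * (\<Sum>n<N. tail (a ^ (n + i))) \<le> - ln ?p" by linarith
    then show ?thesis unfolding pos_le_divide_eq[OF c] by (simp only: mult.commute)
  qed
  then have "summable (\<lambda>n. tail (a ^ (n + i)))"
    by (intro summableI_nonneg_bounded tail_nonneg)
  then show False using assms summable_iff_shift[of "\<lambda>j. tail (a ^ j)" i] by simp
qed

text \<open>A bounded component must avoid some \<open>cone (1 / 2) (a ^ i)\<close>, since a hit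
  puts \<open>ball 0 (a ^ i / 2)\<close> inside the component; the avoidance events are countably
  many null sets.\<close>

lemma prob_bounded_eq_0:
  assumes "\<not> summable (\<lambda>j. tail (a ^ j))"
  shows "prob {\<omega> \<in> space M. bounded (origin_component (Z UNIV \<omega>))} = 0"
proof -
  let ?E = "\<lambda>i. {\<omega> \<in> space M. Z UNIV \<omega> \<inter> cone (1 / 2) (a ^ i) = {}}"
  have "{\<omega> \<in> space M. bounded (origin_component (Z UNIV \<omega>))} \<subseteq> (\<Union>i. ?E i)"
  proof
    fix \<omega> assume "\<omega> \<in> {\<omega> \<in> space M. bounded (origin_component (Z UNIV \<omega>))}"
    then have \<omega>: "\<omega> \<in> space M" and "bounded (origin_component (Z UNIV \<omega>))" by auto
    then obtain R where R: "origin_component (Z UNIV \<omega>) \<subseteq> ball 0 R" using bounded_subset_ballD by blast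
    obtain i where i: "2 * \<bar>R\<bar> < a ^ i" using real_arch_pow[OF a_gt_1] by blast
    have "Z UNIV \<omega> \<inter> cone (1 / 2) (a ^ i) = {}"
    proof (rule ccontr)
      assume "Z UNIV \<omega> \<inter> cone (1 / 2) (a ^ i) \<noteq> {}"
      then obtain c r where cr: "(c, r) \<in> Z UNIV \<omega>" "norm c < r / 2" "a ^ i < r"
        by (auto simp: cone_def)
      have "ball 0 (a ^ i / 2) \<subseteq> ball c r"
        using cr(2,3) by (simp add: ball_subset_ball_iff)
      also have "\<dots> \<subseteq> covered (Z UNIV \<omega>)" using cr(1) by (auto simp: covered_def)
      finally have "ball 0 (a ^ i / 2) \<subseteq> origin_component (Z UNIV \<omega>)"
        unfolding origin_component_def using a_pow_pos[of i]
        by (intro connected_component_maximal) auto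
      then have "ball 0 (a ^ i / 2) \<subseteq> ball (0::'a) R" using R by blast
      then show False using i a_pow_pos[of i] by (simp add: ball_subset_ball_iff)
    qed
    then show "\<omega> \<in> (\<Union>i. ?E i)" using \<omega> by blast
  qed
  moreover have "?E i \<in> null_sets M" for i
  proof (rule null_setsI)
    show "emeasure M (?E i) = 0" unfolding emeasure_eq_measure prob_no_cone[OF assms] by simp
  qed (rule Z_void_event[OF borel_cone])
  then have null: "(\<Union>i. ?E i) \<in> null_sets M" by (rule null_sets_UN)
  ultimately have "{\<omega> \<in> space M. bounded (origin_component (Z UNIV \<omega>))} \<in> null_sets M"
    using null_sets_subset bounded_component_event by blast
  then show ?thesis by (rule measure_eq_0_null_sets)
qed

end

section \<open>Equivalence of almost sure boundedness at small intensity and the logarithmic moment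
  condition\<close>

theorem theorem1p8:
  fixes a :: real
    and \<nu> :: "real measure"
    and M :: "real \<Rightarrow> 'w measure"
    and \<xi> :: "real \<Rightarrow> nat \<Rightarrow> 'w \<Rightarrow> ('a::euclidean_space \<times> real) set"
  assumes "a > 1"
    and "prob_space \<nu>"
    and "sets \<nu> = sets (restrict_space borel {0<..})"
    and "(\<integral>\<^sup>+ r. ennreal (r ^ DIM('a)) \<partial>\<nu>) < \<infinity>"
    and "\<And>lam. lam > 0 \<Longrightarrow>
           independent_poisson_sequence (M lam) (boolean_intensity lam \<nu>) (\<xi> lam)"
  shows "(\<exists>lam0>0. \<forall>lam\<in>{0<..<lam0}.
            measure (M lam) {\<omega> \<in> space (M lam).
              bounded (origin_component (multiscale a (\<lambda>n. \<xi> lam n \<omega>)))} = 1)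
         \<longleftrightarrow> (\<integral>\<^sup>+ \<beta>\<in>{1..}. ennreal (\<beta> ^ DIM('a) * ln \<beta>) \<partial>\<nu>) < \<infinity>"
    (is "?L \<longleftrightarrow> ?R")
proof -
  have loc: "multiscale_boolean (M lam) a lam \<nu> (\<xi> lam)" if "lam > 0" for lam
  proof -
    have ips: "independent_poisson_sequence (M lam) (boolean_intensity lam \<nu>) (\<xi> lam)"
      using assms(5)[OF that] .
    then have "prob_space (M lam)"
      by (simp add: independent_poisson_sequence_def poisson_point_process_def)
    then show ?thesis
      using assms(1-4) ips that by (intro multiscale_boolean.intro multiscale_boolean_axioms.intro)
  qed
  show ?thesis
  proof
    assume ?L
    then obtain lam0 where lam0: "lam0 > 0"
      "\<And>lam. 0 < lam \<Longrightarrow> lam < lam0 \<Longrightarrow> measure (M lam) {\<omega> \<in> space (M lam).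
              bounded (origin_component (multiscale a (\<lambda>n. \<xi> lam n \<omega>)))} = 1" by auto
    \<comment> \<open>Any intensity in the interval would do: divergence gives probability 0 at
      every positive intensity.\<close>
    interpret B: multiscale_boolean "M (lam0 / 2)" a "lam0 / 2" \<nu> "\<xi> (lam0 / 2)"
      using loc lam0(1) by simp
    show ?R
    proof (rule ccontr)
      assume "\<not> ?R"
      then have "\<not> summable (\<lambda>j. B.tail (a ^ j))" using B.summable_tail_iff by blast
      then show False
        using B.prob_bounded_eq_0 lam0(2)[of "lam0 / 2"] lam0(1) by (simp add: multiscale_eq_scales)
    qed
  next
    assume R: ?R
    \<comment> \<open>Intensity 1 gives access to \<open>tail\<close> and \<open>v\<close>, which
      depend only on \<nu> and the dimension, so that \<open>D\<close> can be fixed before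
      \<open>lam\<close>.\<close>
    interpret B1: multiscale_boolean "M 1" a 1 \<nu> "\<xi> 1" using loc by simp
    obtain k where k: "6 < a ^ k" using real_arch_pow[OF assms(1)] by blast
    then have k1: "k \<ge> 1" by (cases k) auto
    obtain Y :: "'a set" where Y: "finite Y" "Y \<subseteq> sphere 0 (a ^ k)" "sphere 0 (a ^ k) \<subseteq> (\<Union>y\<in>Y. ball y 1)"
      using sphere_finite_cover[of "a ^ k"] by blast
    obtain Y' :: "'a set" where Y': "finite Y'" "Y' \<subseteq> sphere 0 (2 * a ^ k)"
        "sphere 0 (2 * a ^ k) \<subseteq> (\<Union>y\<in>Y'. ball y 1)"
      using sphere_finite_cover[of "2 * a ^ k"] by blast
    define D where "D = 4 * real (card Y * card Y') * B1.v * (3 * a ^ k) ^ DIM('a) *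
      ((\<Sum>j. B1.tail (a ^ j)) + real k)"
    have sum: "summable (\<lambda>j. B1.tail (a ^ j))" using R B1.summable_tail_iff by blast
    have "D \<ge> 0"
      unfolding D_def using B1.v_pos assms(1) suminf_nonneg[OF sum B1.tail_nonneg] by simp
    \<comment> \<open>The threshold ensures \<open>lam * D \<le> 1\<close>, which is
      \<open>small\<close>; the \<open>+ 1\<close> keeps it positive given only
      \<open>D \<ge> 0\<close>, as division by 0 yields 0.\<close>
    show ?L
    proof (intro exI[of _ "1 / (D + 1)"] conjI ballI)
      show "0 < 1 / (D + 1)" using \<open>D \<ge> 0\<close> by simp
      fix lam assume lam: "lam \<in> {0<..<1 / (D + 1)}"
      interpret B: multiscale_boolean "M lam" a lam \<nu> "\<xi> lam" using loc lam by simp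
      have "lam * (D + 1) < 1" using lam \<open>D \<ge> 0\<close> by (simp add: pos_less_divide_eq)
      then have small: "lam * D \<le> 1" using lam by (simp add: distrib_left)
      show "measure (M lam) {\<omega> \<in> space (M lam).
          bounded (origin_component (multiscale a (\<lambda>n. \<xi> lam n \<omega>)))} = 1"
        unfolding multiscale_eq_scales
        using sum small k unfolding D_def
        by (intro B.prob_bounded_eq_1[OF _ k1 _ Y(3,2,1) Y'(3,2,1)]) auto
    qed
  qed
qed

end
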